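(* Let $k$ be a field of characteristic zero, let $q,r\geq 2$ be integers with $\gcd(q,r)=1$, let $m\geq 0$ be an integer and let $\underline{n}=(n_0,\ldots,n_m)$ be an $(m+1)$-tuple of integers $n_i>1$. Then the $k$-algebras $R_m(\underline{n},p)^{[1]}$, where $p$ ranges over $k[u]\setminus uk[u]$ (that is, over the polynomials $p\in k[u]$ with $p(0)\neq 0$), are all isomorphic.
   Context: Set $\underline{x}^{\underline{n}}=\prod_{i=0}^{m}x_{i}^{n_{i}}$, $\underline{x}=\prod_{i=0}^m x_i$, and $$R_m(\underline{n},p)=k[x_0,\ldots,x_m,y,z,t]/\left(\underline{x}^{\underline{n}}y +z^q+t^r+x_0p(\underline{x})\right).$$ For a ring $R$, $R^{[1]}$ denotes a polynomial ring in one variable over $R$. *)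

theory Defs
  imports
    "HOL-Library.Poly_Mapping"
    "HOL-Computational_Algebra.Polynomial"
    "HOL-Algebra.UnivPoly"
    "HOL-Algebra.QuotRing"
    "HOL-Algebra.Algebraic_Closure_Type"
begin

text \<open>
  Since \<^typ>\<open>'v \<Rightarrow>\<^sub>0 nat\<close> is the monoid of monomials in variables of type \<^typ>\<open>'v\<close>,
  the type \<open>('v \<Rightarrow>\<^sub>0 nat) \<Rightarrow>\<^sub>0 'k\<close> carries the polynomial ring over \<open>'k\<close> in all these variables.
  The ring \<open>mpoly_ring V\<close> below is the subring of polynomials that only involve variables from \<open>V\<close>.
\<close>

type_synonym ('v, 'k) mpoly = "('v \<Rightarrow>\<^sub>0 nat) \<Rightarrow>\<^sub>0 'k"

definition Const :: "'k::comm_ring_1 \<Rightarrow> ('v, 'k) mpoly"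
  where "Const c = Poly_Mapping.single 0 c"

definition Var :: "'v \<Rightarrow> ('v, 'k::comm_ring_1) mpoly"
  where "Var v = Poly_Mapping.single (Poly_Mapping.single v 1) 1"

definition mpoly_ring :: "'v set \<Rightarrow> ('v, 'k::comm_ring_1) mpoly ring"
  where "mpoly_ring V =
    \<lparr>carrier = {f. \<forall>a \<in> Poly_Mapping.keys f. Poly_Mapping.keys a \<subseteq> V},
     monoid.mult = (*), one = 1, zero = 0, add = (+)\<rparr>"

text \<open>
  A \<open>'k\<close>-algebra is a ring together with a structure map from \<open>'k\<close>. An isomorphism of
  \<open>'k\<close>-algebras is a ring isomorphism commuting with the structure maps.
\<close>

definition algebra_isomorphic ::
    "('k \<Rightarrow> 'a) \<Rightarrow> ('a, 'm) ring_scheme \<Rightarrow> ('k \<Rightarrow> 'b) \<Rightarrow> ('b, 'n) ring_scheme \<Rightarrow> bool"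
  where "algebra_isomorphic s A t B \<longleftrightarrow> (\<exists>h \<in> ring_iso A B. \<forall>c. h (s c) = t c)"

datatype var = VX nat | VY | VZ | VT

definition ambient_vars :: "nat \<Rightarrow> var set"
  where "ambient_vars m = VX ` {..m} \<union> {VY, VZ, VT}"

definition ambient_ring :: "nat \<Rightarrow> (var, 'k::comm_ring_1) mpoly ring"
  where "ambient_ring m = mpoly_ring (ambient_vars m)"

definition relator ::
    "nat \<Rightarrow> (nat \<Rightarrow> nat) \<Rightarrow> nat \<Rightarrow> nat \<Rightarrow> 'k::comm_ring_1 poly \<Rightarrow> (var, 'k) mpoly"
  where "relator m n q r p =
    (\<Prod>i\<le>m. Var (VX i) ^ n i) * Var VY + Var VZ ^ q + Var VT ^ r
      + Var (VX 0) * poly (map_poly Const p) (\<Prod>i\<le>m. Var (VX i))"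

definition relation_ideal ::
    "nat \<Rightarrow> (nat \<Rightarrow> nat) \<Rightarrow> nat \<Rightarrow> nat \<Rightarrow> 'k::comm_ring_1 poly \<Rightarrow> (var, 'k) mpoly set"
  where "relation_ideal m n q r p = PIdl\<^bsub>ambient_ring m\<^esub> (relator m n q r p)"

definition R_alg ::
    "nat \<Rightarrow> (nat \<Rightarrow> nat) \<Rightarrow> nat \<Rightarrow> nat \<Rightarrow> 'k::comm_ring_1 poly \<Rightarrow> (var, 'k) mpoly set ring"
  where "R_alg m n q r p = ambient_ring m Quot relation_ideal m n q r p"

definition R_scalar ::
    "nat \<Rightarrow> (nat \<Rightarrow> nat) \<Rightarrow> nat \<Rightarrow> nat \<Rightarrow> 'k::comm_ring_1 poly \<Rightarrow> 'k \<Rightarrow> (var, 'k) mpoly set"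
  where "R_scalar m n q r p c = relation_ideal m n q r p +>\<^bsub>ambient_ring m\<^esub> Const c"

text \<open>The structure map of the polynomial ring \<^term>\<open>UP A\<close> over an algebra \<open>A\<close>.\<close>

definition UP_scalar :: "('k \<Rightarrow> 'a) \<Rightarrow> ('a, 'm) ring_scheme \<Rightarrow> 'k \<Rightarrow> nat \<Rightarrow> 'a"
  where "UP_scalar s A c = up_ring.monom (UP A) (s c) 0"


text \<open>The objects above are indeed commutative rings and ring homomorphisms from \<open>'k\<close>.\<close>

lemma mpoly_ring_simps [simp]:
  "monoid.mult (mpoly_ring V) = (*)" "one (mpoly_ring V) = 1"
  "zero (mpoly_ring V) = 0" "add (mpoly_ring V) = (+)"
  by (simp_all add: mpoly_ring_def)

lemma mem_mpoly_ring_iff: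
  "f \<in> carrier (mpoly_ring V) \<longleftrightarrow> (\<forall>a \<in> Poly_Mapping.keys f. Poly_Mapping.keys a \<subseteq> V)"
  by (simp add: mpoly_ring_def)

lemma mpoly_ring_closed:
  "0 \<in> carrier (mpoly_ring V)" "1 \<in> carrier (mpoly_ring V)"
  "Const c \<in> carrier (mpoly_ring V)"
  "v \<in> V \<Longrightarrow> Var v \<in> carrier (mpoly_ring V)"
  "f \<in> carrier (mpoly_ring V) \<Longrightarrow> g \<in> carrier (mpoly_ring V) \<Longrightarrow> f + g \<in> carrier (mpoly_ring V)"
  "f \<in> carrier (mpoly_ring V) \<Longrightarrow> g \<in> carrier (mpoly_ring V) \<Longrightarrow> f * g \<in> carrier (mpoly_ring V)"
  "f \<in> carrier (mpoly_ring V) \<Longrightarrow> - f \<in> carrier (mpoly_ring V)"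
proof -
  show "f + g \<in> carrier (mpoly_ring V)"
    if "f \<in> carrier (mpoly_ring V)" "g \<in> carrier (mpoly_ring V)"
    using that Poly_Mapping.keys_add[of f g] unfolding mem_mpoly_ring_iff by blast
  show "f * g \<in> carrier (mpoly_ring V)"
    if "f \<in> carrier (mpoly_ring V)" "g \<in> carrier (mpoly_ring V)"
    unfolding mem_mpoly_ring_iff
  proof
    fix c assume "c \<in> Poly_Mapping.keys (f * g)"
    then obtain a b where "c = a + b" "a \<in> Poly_Mapping.keys f" "b \<in> Poly_Mapping.keys g"
      using keys_mult[of f g] by blast
    then show "Poly_Mapping.keys c \<subseteq> V"
      using that Poly_Mapping.keys_add[of a b] unfolding mem_mpoly_ring_iff by blast
  qed
qed (auto simp: mem_mpoly_ring_iff Const_def Var_def)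

lemma mpoly_ring_power_closed:
  "f \<in> carrier (mpoly_ring V) \<Longrightarrow> f ^ j \<in> carrier (mpoly_ring V)"
  by (induction j) (auto intro: mpoly_ring_closed)

lemma mpoly_ring_prod_closed:
  "(\<And>i. i \<in> I \<Longrightarrow> f i \<in> carrier (mpoly_ring V)) \<Longrightarrow> prod f I \<in> carrier (mpoly_ring V)"
  by (induction I rule: infinite_finite_induct) (auto intro: mpoly_ring_closed)

lemma mpoly_ring_poly_closed:
  assumes "f \<in> carrier (mpoly_ring V)"
  shows "poly (map_poly Const p) f \<in> carrier (mpoly_ring V)"
  by (induction p)
    (auto simp: map_poly_pCons Const_def[of 0] intro!: mpoly_ring_closed assms)

lemma cring_mpoly_ring: "cring (mpoly_ring V :: ('v, 'k::comm_ring_1) mpoly ring)"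
proof (rule cringI)
  show "abelian_group (mpoly_ring V :: ('v, 'k) mpoly ring)"
  proof (rule abelian_groupI)
    fix f :: "('v, 'k) mpoly" assume "f \<in> carrier (mpoly_ring V)"
    then show "\<exists>g \<in> carrier (mpoly_ring V). g \<oplus>\<^bsub>mpoly_ring V\<^esub> f = \<zero>\<^bsub>mpoly_ring V\<^esub>"
      by (intro bexI[of _ "- f"]) (auto intro: mpoly_ring_closed)
  qed (auto simp: ac_simps intro: mpoly_ring_closed)
  show "Group.comm_monoid (mpoly_ring V :: ('v, 'k) mpoly ring)"
    by (rule comm_monoidI) (auto simp: ac_simps intro: mpoly_ring_closed)
qed (auto simp: algebra_simps)

lemma cring_ambient_ring: "cring (ambient_ring m)"
  unfolding ambient_ring_def by (rule cring_mpoly_ring)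

lemma relator_closed: "relator m n q r p \<in> carrier (ambient_ring m)"
  unfolding relator_def ambient_ring_def
  by (intro mpoly_ring_closed mpoly_ring_power_closed mpoly_ring_prod_closed
      mpoly_ring_poly_closed) (auto simp: ambient_vars_def)

lemma ideal_relation_ideal: "ideal (relation_ideal m n q r p) (ambient_ring m)"
  unfolding relation_ideal_def
  by (rule cring.cgenideal_ideal[OF cring_ambient_ring relator_closed])

lemma cring_R_alg: "cring (R_alg m n q r p)"
  unfolding R_alg_def by (rule ideal.quotient_is_cring[OF ideal_relation_ideal cring_ambient_ring])

lemma R_scalar_hom:
  "R_scalar m n q r p \<in> ring_hom ring_of_type_algebra (R_alg m n q r (p :: 'k::comm_ring_1 poly))"
proof -
  have "(Const :: 'k \<Rightarrow> _) \<in> ring_hom ring_of_type_algebra (ambient_ring m)"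
    unfolding ambient_ring_def
    by (rule ring_hom_memI)
      (auto simp: ring_of_type_algebra_def Const_def mult_single single_add
        intro: mpoly_ring_closed(3)[unfolded Const_def])
  from ring_hom_trans[OF this ideal.rcos_ring_hom[OF ideal_relation_ideal]]
  show ?thesis by (simp add: R_alg_def R_scalar_def[abs_def] comp_def)
qed

lemma UP_scalar_hom:
  assumes "cring A" "s \<in> ring_hom K A"
  shows "UP_scalar s A \<in> ring_hom K (UP A)"
proof -
  interpret UP_cring A "UP A" using assms(1) by (simp add: UP_cring_def)
  show ?thesis
    using ring_hom_trans[OF assms(2) const_ring_hom] by (simp add: UP_scalar_def[abs_def] comp_def)
qed

end

theory Submission
  imports Defs
begin

text \<open>
  Let \<open>w\<close> be the extra variable, \<open>u\<close> the product of the \<open>x\<^sub>i\<close>, \<open>M\<close> the product of the \<open>x\<^sub>i\<^bsup>n\<^sub>i\<^esup>\<close>, and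
  \<open>F\<^sub>p\<close> the relator. For \<open>c = p'(0) / p(0)\<close> there is a polynomial \<open>\<nu>(u)\<close> with
  \<open>\<nu>\<^sup>q\<^sup>r p'(u) \<equiv> c p(c u)\<close> modulo a high power of \<open>u\<close>, hence modulo \<open>M\<close>. Modulo \<open>M\<close>, the substitution
  \<open>x\<^sub>0 \<mapsto> c x\<^sub>0\<close>, \<open>z \<mapsto> \<nu>\<^sup>r z\<close>, \<open>t \<mapsto> \<nu>\<^sup>q t\<close> therefore sends \<open>F\<^sub>p\<close> to \<open>\<nu>\<^sup>q\<^sup>r F\<^bsub>p'\<^esub>\<close>, a unit times \<open>F\<^bsub>p'\<^esub>\<close>.
  The matrix \<open>diag(\<nu>\<^sup>r, \<nu>\<^sup>q)\<close> does not lift to an invertible matrix over \<open>k[u]\<close>, but with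
  the help of \<open>w\<close> it can be completed to one of determinant \<open>1\<close>, which lifts. Adjusting the
  image of \<open>y\<close> turns the lifted substitution into one sending \<open>F\<^sub>p\<close> to \<open>\<nu>\<^sup>q\<^sup>r F\<^bsub>p'\<^esub>\<close> exactly.
  The analogous substitution built from the inverse matrix is inverse to it modulo the relators:
  on \<open>y\<close> this follows by cancelling \<open>M\<close>.
\<close>

subsection \<open>Ring homomorphisms between type-class rings\<close>

text \<open>Homomorphisms are total functions between types, so algebraic rewriting needs no carrier
  premises; membership in subrings is tracked separately.\<close>

locale ring_homomorphism =
  fixes h :: "'a::comm_ring_1 \<Rightarrow> 'b::comm_ring_1"
  assumes hom_add: "h (x + y) = h x + h y"
    and hom_mult: "h (x * y) = h x * h y"
    and hom_one: "h 1 = 1"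
begin

lemma hom_zero: "h 0 = 0"
  using hom_add[of 0 0] by simp

lemma hom_uminus: "h (- x) = - h x"
  using hom_add[of x "- x"] by (simp add: hom_zero eq_neg_iff_add_eq_0 add.commute)

lemma hom_diff: "h (x - y) = h x - h y"
  using hom_add[of x "- y"] by (simp add: hom_uminus)

lemma hom_power: "h (x ^ j) = h x ^ j"
  by (induction j) (simp_all add: hom_mult hom_one)

lemma hom_prod: "h (prod f I) = (\<Prod>i\<in>I. h (f i))"
  by (induction I rule: infinite_finite_induct) (simp_all add: hom_mult hom_one)

lemmas hom_simps = hom_add hom_mult hom_one hom_zero hom_uminus hom_diff hom_power hom_prod

lemma map_poly_add: "map_poly h (f + g) = map_poly h f + map_poly h g"
  by (intro poly_eqI) (simp add: coeff_map_poly hom_zero hom_add)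

lemma poly_map_poly_hom: "ring_homomorphism (\<lambda>f. poly (map_poly h f) w)"
proof
  fix f g
  have smult: "poly (map_poly h (smult c g)) w = h c * poly (map_poly h g) w" for c g
    by (simp add: map_poly_smult hom_zero hom_mult)
  show "poly (map_poly h (f * g)) w = poly (map_poly h f) w * poly (map_poly h g) w"
    by (induction f)
      (simp_all add: map_poly_pCons map_poly_add hom_zero smult algebra_simps)
qed (simp_all add: map_poly_add hom_one)

end

lemma ring_homomorphism_comp:
  assumes "ring_homomorphism g" "ring_homomorphism h"
  shows "ring_homomorphism (\<lambda>x. g (h x))"
  using assms by (simp add: ring_homomorphism_def)

lemma ring_homomorphism_const_poly: "ring_homomorphism (\<lambda>c. [:c:])"
  by (simp add: ring_homomorphism_def one_pCons)

lemma ring_homomorphism_Const: "ring_homomorphism Const"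
  by (simp add: ring_homomorphism_def Const_def mult_single single_add)

subsection \<open>Evaluation of multivariate polynomials\<close>

definition monomial_eval :: "('v \<Rightarrow> 'a) \<Rightarrow> ('v \<Rightarrow>\<^sub>0 nat) \<Rightarrow> 'a::comm_ring_1"
  where "monomial_eval e a = (\<Prod>v\<in>Poly_Mapping.keys a. e v ^ Poly_Mapping.lookup a v)"

text \<open>The universal property of polynomial rings: for a homomorphism \<open>s\<close> this is
  the homomorphism that extends \<open>s\<close> on constants and \<open>e\<close> on
  variables.\<close>

definition mpoly_eval ::
    "('k::comm_ring_1 \<Rightarrow> 'a) \<Rightarrow> ('v \<Rightarrow> 'a) \<Rightarrow> ('v, 'k) mpoly \<Rightarrow> 'a::comm_ring_1"
  where "mpoly_eval s e f = (\<Sum>a\<in>Poly_Mapping.keys f. s (Poly_Mapping.lookup f a) * monomial_eval e a)"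

text \<open>Variables outside the support contribute \<open>e v ^ 0 = 1\<close>; a common index set
  lets several monomials be compared factor by factor.\<close>

lemma monomial_eval_superset:
  assumes "finite S" "Poly_Mapping.keys a \<subseteq> S"
  shows "monomial_eval e a = (\<Prod>v\<in>S. e v ^ Poly_Mapping.lookup a v)"
  unfolding monomial_eval_def
  by (rule prod.mono_neutral_left) (use assms in \<open>auto simp: in_keys_iff\<close>)

lemma monomial_eval_add: "monomial_eval e (a + b) = monomial_eval e a * monomial_eval e b"
proof -
  define S where "S = Poly_Mapping.keys a \<union> Poly_Mapping.keys b"
  have "finite S" "Poly_Mapping.keys a \<subseteq> S" "Poly_Mapping.keys b \<subseteq> S"
    "Poly_Mapping.keys (a + b) \<subseteq> S"
    using Poly_Mapping.keys_add[of a b] by (auto simp: S_def)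
  then show ?thesis
    by (simp add: monomial_eval_superset lookup_add power_add prod.distrib)
qed

lemma mpoly_eval_single:
  assumes "ring_homomorphism s"
  shows "mpoly_eval s e (Poly_Mapping.single a c) = s c * monomial_eval e a"
  using ring_homomorphism.hom_zero[OF assms] by (simp add: mpoly_eval_def)

lemma mpoly_eval_superset:
  assumes "ring_homomorphism s" "finite S" "Poly_Mapping.keys f \<subseteq> S"
  shows "mpoly_eval s e f = (\<Sum>a\<in>S. s (Poly_Mapping.lookup f a) * monomial_eval e a)"
  unfolding mpoly_eval_def
  by (rule sum.mono_neutral_left)
    (use assms in \<open>auto simp: in_keys_iff ring_homomorphism.hom_zero\<close>)

lemma mpoly_eval_add:
  assumes "ring_homomorphism s"
  shows "mpoly_eval s e (f + g) = mpoly_eval s e f + mpoly_eval s e g"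
proof -
  define S where "S = Poly_Mapping.keys f \<union> Poly_Mapping.keys g"
  have "finite S" "Poly_Mapping.keys f \<subseteq> S" "Poly_Mapping.keys g \<subseteq> S"
    "Poly_Mapping.keys (f + g) \<subseteq> S"
    using Poly_Mapping.keys_add[of f g] by (auto simp: S_def)
  then show ?thesis
    by (simp add: mpoly_eval_superset[OF assms] lookup_add ring_homomorphism.hom_add[OF assms]
        distrib_right sum.distrib)
qed

lemma poly_mapping_sum_single:
  fixes f :: "'a \<Rightarrow>\<^sub>0 'b::comm_monoid_add"
  shows "(\<Sum>a\<in>Poly_Mapping.keys f. Poly_Mapping.single a (Poly_Mapping.lookup f a)) = f"
  by (rule poly_mapping_eqI) (simp add: lookup_sum lookup_single when_def in_keys_iff)

text \<open>The case \<open>single\<close> offers only terms that occur in \<open>f\<close>, so that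
  a hypothesis on the support of \<open>f\<close> remains usable there.\<close>

lemma poly_mapping_single_induct [case_names zero single add]:
  fixes f :: "'a \<Rightarrow>\<^sub>0 'b::comm_monoid_add"
  assumes "P 0" and "\<And>a. a \<in> Poly_Mapping.keys f \<Longrightarrow> P (Poly_Mapping.single a (Poly_Mapping.lookup f a))"
    and "\<And>g h. P g \<Longrightarrow> P h \<Longrightarrow> P (g + h)"
  shows "P f"
proof -
  have "P (\<Sum>a\<in>S. Poly_Mapping.single a (Poly_Mapping.lookup f a))" if "S \<subseteq> Poly_Mapping.keys f" for S
    using finite_subset[OF that finite_keys] that
    by (induction rule: finite_induct) (use assms in auto)
  from this[OF subset_refl] show ?thesis by (simp only: poly_mapping_sum_single)
qed

lemma ring_homomorphism_mpoly_eval: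
  assumes "ring_homomorphism s"
  shows "ring_homomorphism (mpoly_eval s e)"
proof
  note eval = mpoly_eval_add[OF assms] mpoly_eval_single[OF assms]
  have zero: "mpoly_eval s e 0 = 0"
    by (simp add: mpoly_eval_def)
  \<comment> \<open>A left factor with one term comes first; the general product then follows by
    additivity in the left factor.\<close>
  have single: "mpoly_eval s e (Poly_Mapping.single a c * g) =
      mpoly_eval s e (Poly_Mapping.single a c) * mpoly_eval s e g" for a c g
  proof (induction g rule: poly_mapping_single_induct)
    case (add g h)
    then show ?case
      by (simp add: distrib_left mpoly_eval_add[OF assms])
  qed (simp_all add: zero eval mult_single monomial_eval_add ring_homomorphism.hom_mult[OF assms]
      mult_ac)
  show "mpoly_eval s e (f * g) = mpoly_eval s e f * mpoly_eval s e g" for f g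
    by (induction f rule: poly_mapping_single_induct)
      (simp_all add: zero single mpoly_eval_add[OF assms] distrib_right)
  show "mpoly_eval s e 1 = 1"
    using mpoly_eval_single[OF assms, of e 0 1]
    by (simp add: monomial_eval_def ring_homomorphism.hom_one[OF assms])
qed (rule mpoly_eval_add[OF assms])

lemma mpoly_eval_Const:
  assumes "ring_homomorphism s"
  shows "mpoly_eval s e (Const c) = s c"
  by (simp add: Const_def mpoly_eval_single[OF assms] monomial_eval_def)

lemma mpoly_eval_Var:
  assumes "ring_homomorphism s"
  shows "mpoly_eval s e (Var v) = e v"
  by (simp add: Var_def mpoly_eval_single[OF assms] monomial_eval_def
      ring_homomorphism.hom_one[OF assms])

lemma Var_power: "Var v ^ j = Poly_Mapping.single (Poly_Mapping.single v j) 1"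
  by (induction j) (simp_all add: Var_def mult_single flip: single_add)

lemma prod_Var_power:
  "(\<Prod>i\<in>I. Var (v i) ^ j i) = Poly_Mapping.single (\<Sum>i\<in>I. Poly_Mapping.single (v i) (j i)) 1"
  by (induction I rule: infinite_finite_induct) (simp_all add: Var_power mult_single)

text \<open>Each term of \<open>f\<close> is a constant times powers of variables from
  \<open>V\<close>, so the constants and these variables generate the carrier.\<close>

lemma mpoly_ring_induct [consumes 1, case_names Const Var add mult]:
  assumes "f \<in> carrier (mpoly_ring V)"
    and Const: "\<And>c. P (Const c)" and Var: "\<And>v. v \<in> V \<Longrightarrow> P (Var v)"
    and add: "\<And>g h. P g \<Longrightarrow> P h \<Longrightarrow> P (g + h)" and mult: "\<And>g h. P g \<Longrightarrow> P h \<Longrightarrow> P (g * h)"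
  shows "P f"
proof -
  have zero: "P 0" and one: "P 1"
    using Const[of 0] Const[of 1] by (simp_all add: Const_def)
  have power: "P (Var v ^ j)" if "v \<in> V" for v j
    by (induction j) (auto intro: one mult Var that)
  have prod: "P (\<Prod>v\<in>S. Var v ^ a v)" if "S \<subseteq> V" for S a
    using that by (induction S rule: infinite_finite_induct) (auto intro: one mult power)
  have monomial_eq: "Poly_Mapping.single a c = Const c * (\<Prod>v\<in>Poly_Mapping.keys a. Var v ^ Poly_Mapping.lookup a v)"
    for a :: "'a \<Rightarrow>\<^sub>0 nat" and c :: 'b
    by (simp add: prod_Var_power poly_mapping_sum_single Const_def mult_single)
  show ?thesis
  proof (induction f rule: poly_mapping_single_induct)
    case (single a)
    then have "Poly_Mapping.keys a \<subseteq> V"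
      using assms(1) by (simp add: mem_mpoly_ring_iff)
    then show ?case
      unfolding monomial_eq by (intro mult Const prod)
  qed (use zero add in auto)
qed

text \<open>Multiplication by a monomial shifts exponents by \<open>a\<close>, so the coefficient of
  \<open>f\<close> at \<open>b\<close> is that of the product at \<open>a + b\<close>. This works
  over any commutative coefficient ring.\<close>

lemma single_times_cancel:
  fixes f g :: "('v, 'k::comm_ring_1) mpoly"
  assumes "Poly_Mapping.single a 1 * f = Poly_Mapping.single a 1 * g"
  shows "f = g"
proof (rule poly_mapping_eqI)
  fix b
  have "Poly_Mapping.lookup (Poly_Mapping.single a 1 * f) (a + b) = Poly_Mapping.lookup f b" for f :: "('v, 'k) mpoly"
    by (simp add: lookup_mult lookup_single Sum_any_when_dependent_prod_left when_mult)
  with assms show "Poly_Mapping.lookup f b = Poly_Mapping.lookup g b" by metis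
qed

subsection \<open>Polynomial rings over quotients\<close>

text \<open>The cylinder before passing to the quotient: polynomials in the extra variable over
  \<open>mpoly_ring V\<close>. Type-class polynomials keep its arithmetic free of carriers;
  \<open>quotient_poly\<close> links it to \<open>UP\<close>.\<close>

definition mpoly_poly_ring :: "'v set \<Rightarrow> ('v, 'k::comm_ring_1) mpoly poly ring"
  where "mpoly_poly_ring V =
    \<lparr>carrier = {g. \<forall>i. poly.coeff g i \<in> carrier (mpoly_ring V)},
     monoid.mult = (*), one = 1, zero = 0, add = (+)\<rparr>"

lemma mpoly_poly_ring_simps [simp]:
  "monoid.mult (mpoly_poly_ring V) = (*)" "one (mpoly_poly_ring V) = 1"
  "zero (mpoly_poly_ring V) = 0" "add (mpoly_poly_ring V) = (+)"
  by (simp_all add: mpoly_poly_ring_def)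

lemma mem_mpoly_poly_ring_iff:
  "g \<in> carrier (mpoly_poly_ring V) \<longleftrightarrow> (\<forall>i. poly.coeff g i \<in> carrier (mpoly_ring V))"
  by (simp add: mpoly_poly_ring_def)

lemma mpoly_ring_sum_closed:
  "(\<And>i. i \<in> I \<Longrightarrow> f i \<in> carrier (mpoly_ring V)) \<Longrightarrow> sum f I \<in> carrier (mpoly_ring V)"
  by (induction I rule: infinite_finite_induct) (auto intro: mpoly_ring_closed)

lemma mpoly_ring_diff_closed:
  "f \<in> carrier (mpoly_ring V) \<Longrightarrow> g \<in> carrier (mpoly_ring V) \<Longrightarrow> f - g \<in> carrier (mpoly_ring V)"
  using mpoly_ring_closed(5)[of f V "- g"] mpoly_ring_closed(7)[of g V] by simp

lemma mpoly_poly_ring_closed: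
  "0 \<in> carrier (mpoly_poly_ring V)" "1 \<in> carrier (mpoly_poly_ring V)"
  "a \<in> carrier (mpoly_ring V) \<Longrightarrow> monom a j \<in> carrier (mpoly_poly_ring V)"
  "a \<in> carrier (mpoly_ring V) \<Longrightarrow> [:a:] \<in> carrier (mpoly_poly_ring V)"
  "f \<in> carrier (mpoly_poly_ring V) \<Longrightarrow> g \<in> carrier (mpoly_poly_ring V)
    \<Longrightarrow> f + g \<in> carrier (mpoly_poly_ring V)"
  "f \<in> carrier (mpoly_poly_ring V) \<Longrightarrow> g \<in> carrier (mpoly_poly_ring V)
    \<Longrightarrow> f - g \<in> carrier (mpoly_poly_ring V)"
  "f \<in> carrier (mpoly_poly_ring V) \<Longrightarrow> g \<in> carrier (mpoly_poly_ring V)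
    \<Longrightarrow> f * g \<in> carrier (mpoly_poly_ring V)"
  "f \<in> carrier (mpoly_poly_ring V) \<Longrightarrow> - f \<in> carrier (mpoly_poly_ring V)"
  by (auto simp: mem_mpoly_poly_ring_iff coeff_mult coeff_pCons coeff_1 split: nat.splits
      intro!: mpoly_ring_closed mpoly_ring_diff_closed mpoly_ring_sum_closed)

lemma mpoly_poly_ring_power_closed:
  "f \<in> carrier (mpoly_poly_ring V) \<Longrightarrow> f ^ j \<in> carrier (mpoly_poly_ring V)"
  by (induction j) (auto intro: mpoly_poly_ring_closed)

lemma mpoly_poly_ring_sum_closed:
  "(\<And>i. i \<in> I \<Longrightarrow> f i \<in> carrier (mpoly_poly_ring V)) \<Longrightarrow> sum f I \<in> carrier (mpoly_poly_ring V)"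
  by (induction I rule: infinite_finite_induct) (auto intro: mpoly_poly_ring_closed)

lemma exists_mpoly_poly_with_coeffs:
  assumes "\<And>i. d i \<in> carrier (mpoly_ring V)" "\<And>i. N < i \<Longrightarrow> d i = 0"
  obtains g where "g \<in> carrier (mpoly_poly_ring V)" "\<And>i. poly.coeff g i = d i"
proof
  show "(\<Sum>j\<le>N. monom (d j) j) \<in> carrier (mpoly_poly_ring V)"
    by (intro mpoly_poly_ring_sum_closed mpoly_poly_ring_closed assms)
  show "poly.coeff (\<Sum>j\<le>N. monom (d j) j) i = d i" for i
    using assms(2)[of i] by (auto simp: coeff_sum)
qed

text \<open>The canonical map from \<open>A[w]\<close> to \<open>(A/I)[w]\<close>. Its values are
  coefficient functions because \<open>UP\<close> represents polynomials in this way.\<close>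

definition quotient_poly ::
    "'v set \<Rightarrow> ('v, 'k::comm_ring_1) mpoly set \<Rightarrow> ('v, 'k) mpoly poly \<Rightarrow> nat \<Rightarrow> ('v, 'k) mpoly set"
  where "quotient_poly V I g = (\<lambda>i. I +>\<^bsub>mpoly_ring V\<^esub> poly.coeff g i)"

context
  fixes V :: "'v set" and I :: "('v, 'k::comm_ring_1) mpoly set"
  assumes I: "ideal I (mpoly_ring V)"
begin

interpretation I: ideal I "mpoly_ring V" by (rule I)

interpretation rcos: ring_hom_cring "mpoly_ring V" "mpoly_ring V Quot I" "(+>\<^bsub>mpoly_ring V\<^esub>) I"
  by (rule I.rcos_ring_hom_cring[OF cring_mpoly_ring])

lemma finsum_mpoly_ring:
  assumes "finite A" "\<And>i. i \<in> A \<Longrightarrow> f i \<in> carrier (mpoly_ring V :: ('v, 'k) mpoly ring)"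
  shows "finsum (mpoly_ring V) f A = sum f A"
  using assms by (induction A rule: finite_induct) (auto simp: I.finsum_insert Pi_def)

lemma quotient_poly_closed:
  assumes "g \<in> carrier (mpoly_poly_ring V)"
  shows "quotient_poly V I g \<in> up (mpoly_ring V Quot I)"
proof (rule mem_upI)
  show "quotient_poly V I g i \<in> carrier (mpoly_ring V Quot I)" for i
    using assms rcos.hom_closed by (simp add: quotient_poly_def mem_mpoly_poly_ring_iff)
  have "quotient_poly V I g i = \<zero>\<^bsub>mpoly_ring V Quot I\<^esub>" if "degree g < i" for i
    unfolding quotient_poly_def coeff_eq_0[OF that] using rcos.hom_zero by simp
  then have "bound \<zero>\<^bsub>mpoly_ring V Quot I\<^esub> (degree g) (quotient_poly V I g)" ..
  then show "\<exists>d. bound \<zero>\<^bsub>mpoly_ring V Quot I\<^esub> d (quotient_poly V I g)" ..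
qed

lemma quotient_poly_hom:
  "quotient_poly V I \<in> ring_hom (mpoly_poly_ring V) (UP (mpoly_ring V Quot I))"
proof (rule ring_hom_memI)
  fix f g :: "('v, 'k) mpoly poly"
  assume fg: "f \<in> carrier (mpoly_poly_ring V)" "g \<in> carrier (mpoly_poly_ring V)"
  note coeffs = fg[unfolded mem_mpoly_poly_ring_iff, rule_format]
  show "quotient_poly V I f \<in> carrier (UP (mpoly_ring V Quot I))"
    using fg quotient_poly_closed by (simp add: UP_def)
  have add: "I +>\<^bsub>mpoly_ring V\<^esub> (a + b) =
      (I +>\<^bsub>mpoly_ring V\<^esub> a) \<oplus>\<^bsub>mpoly_ring V Quot I\<^esub> (I +>\<^bsub>mpoly_ring V\<^esub> b)"
    if "a \<in> carrier (mpoly_ring V)" "b \<in> carrier (mpoly_ring V)" for a b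
    using rcos.hom_add[OF that] by simp
  have mult: "I +>\<^bsub>mpoly_ring V\<^esub> (a * b) =
      (I +>\<^bsub>mpoly_ring V\<^esub> a) \<otimes>\<^bsub>mpoly_ring V Quot I\<^esub> (I +>\<^bsub>mpoly_ring V\<^esub> b)"
    if "a \<in> carrier (mpoly_ring V)" "b \<in> carrier (mpoly_ring V)" for a b
    using rcos.hom_mult[OF that] by simp
  show "quotient_poly V I (f \<oplus>\<^bsub>mpoly_poly_ring V\<^esub> g) =
      quotient_poly V I f \<oplus>\<^bsub>UP (mpoly_ring V Quot I)\<^esub> quotient_poly V I g"
    using quotient_poly_closed[OF fg(1)] quotient_poly_closed[OF fg(2)]
    by (simp add: UP_def) (simp add: quotient_poly_def add coeffs)
  have "I +>\<^bsub>mpoly_ring V\<^esub> poly.coeff (f * g) i =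
      (\<Oplus>\<^bsub>mpoly_ring V Quot I\<^esub>j\<in>{..i}. (I +>\<^bsub>mpoly_ring V\<^esub> poly.coeff f j)
        \<otimes>\<^bsub>mpoly_ring V Quot I\<^esub> (I +>\<^bsub>mpoly_ring V\<^esub> poly.coeff g (i - j)))" for i
  proof -
    have "poly.coeff (f * g) i =
        (\<Oplus>\<^bsub>mpoly_ring V\<^esub>j\<in>{..i}. poly.coeff f j * poly.coeff g (i - j))"
      by (subst finsum_mpoly_ring) (auto simp: coeff_mult intro: mpoly_ring_closed coeffs)
    then show ?thesis
      by (simp add: rcos.hom_finsum Pi_def mpoly_ring_closed coeffs comp_def mult[symmetric])
  qed
  then show "quotient_poly V I (f \<otimes>\<^bsub>mpoly_poly_ring V\<^esub> g) =
      quotient_poly V I f \<otimes>\<^bsub>UP (mpoly_ring V Quot I)\<^esub> quotient_poly V I g"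
    using quotient_poly_closed[OF fg(1)] quotient_poly_closed[OF fg(2)]
    by (simp add: UP_def) (simp add: quotient_poly_def)
next
  show "quotient_poly V I \<one>\<^bsub>mpoly_poly_ring V\<^esub> = \<one>\<^bsub>UP (mpoly_ring V Quot I)\<^esub>"
    using rcos.hom_one rcos.hom_zero by (auto simp: UP_def quotient_poly_def fun_eq_iff coeff_1)
qed

lemma quotient_poly_surj:
  "quotient_poly V I ` carrier (mpoly_poly_ring V) = carrier (UP (mpoly_ring V Quot I))"
proof
  show "quotient_poly V I ` carrier (mpoly_poly_ring V) \<subseteq> carrier (UP (mpoly_ring V Quot I))"
    using quotient_poly_closed by (auto simp: UP_def)
  show "carrier (UP (mpoly_ring V Quot I)) \<subseteq> quotient_poly V I ` carrier (mpoly_poly_ring V)"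
  proof
    fix \<alpha> assume "\<alpha> \<in> carrier (UP (mpoly_ring V Quot I))"
    then have \<alpha>: "\<alpha> \<in> up (mpoly_ring V Quot I)" by (simp add: UP_def)
    then obtain N where N: "bound \<zero>\<^bsub>mpoly_ring V Quot I\<^esub> N \<alpha>"
      using rcos.S.bound_upD by blast
    \<comment> \<open>Above the bound \<open>N\<close> the representative is taken to be
      \<open>0\<close> and not just any element of \<open>I\<close>, so that the lifted coefficients
      form a polynomial.\<close>
    have "\<exists>a\<in>carrier (mpoly_ring V). \<alpha> i = I +>\<^bsub>mpoly_ring V\<^esub> a \<and> (N < i \<longrightarrow> a = 0)" for i
    proof (cases "N < i")
      case True
      then show ?thesis
        using bound.bound[OF N True] rcos.hom_zero
        by (intro bexI[of _ 0]) (auto intro: mpoly_ring_closed)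
    next
      case False
      then show ?thesis
        using mem_upD[OF \<alpha>, of i] by (auto simp: FactRing_def A_RCOSETS_def')
    qed
    then obtain d where d: "\<And>i. d i \<in> carrier (mpoly_ring V)"
        "\<And>i. \<alpha> i = I +>\<^bsub>mpoly_ring V\<^esub> d i" "\<And>i. N < i \<Longrightarrow> d i = 0"
      by metis
    obtain g where "g \<in> carrier (mpoly_poly_ring V)" "\<And>i. poly.coeff g i = d i"
      using exists_mpoly_poly_with_coeffs[of d V N] d by blast
    then show "\<alpha> \<in> quotient_poly V I ` carrier (mpoly_poly_ring V)"
      by (intro image_eqI[of _ _ g]) (auto simp: quotient_poly_def d(2))
  qed
qed

lemma quotient_poly_const:
  assumes "a \<in> carrier (mpoly_ring V)"
  shows "quotient_poly V I [:a:] =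
    up_ring.monom (UP (mpoly_ring V Quot I)) (I +>\<^bsub>mpoly_ring V\<^esub> a) 0"
  using rcos.hom_closed[OF assms] rcos.hom_zero
  by (auto simp: quotient_poly_def UP_def coeff_pCons fun_eq_iff split: nat.splits)

end

text \<open>A polynomial whose coefficients are all multiples of \<open>F\<close> is
  \<open>[:F:]\<close> times the polynomial of cofactors, so the kernel of the reduction is the
  principal ideal of \<open>[:F:]\<close>.\<close>

lemma quotient_poly_eq_iff:
  fixes F :: "('v, 'k::comm_ring_1) mpoly"
  assumes F: "F \<in> carrier (mpoly_ring V)"
    and f: "f \<in> carrier (mpoly_poly_ring V)" and g: "g \<in> carrier (mpoly_poly_ring V)"
  shows "quotient_poly V (PIdl\<^bsub>mpoly_ring V\<^esub> F) f = quotient_poly V (PIdl\<^bsub>mpoly_ring V\<^esub> F) g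
    \<longleftrightarrow> (\<exists>d\<in>carrier (mpoly_poly_ring V). f - g = [:F:] * d)"
    (is "?E f = ?E g \<longleftrightarrow> ?R")
proof -
  interpret cring "mpoly_ring V :: ('v, 'k) mpoly ring" by (rule cring_mpoly_ring)
  have I: "ideal (PIdl\<^bsub>mpoly_ring V\<^esub> F) (mpoly_ring V)"
    by (rule cgenideal_ideal[OF F])
  have minus: "a \<ominus>\<^bsub>mpoly_ring V\<^esub> b = a - b"
    if "a \<in> carrier (mpoly_ring V)" "b \<in> carrier (mpoly_ring V)" for a b :: "('v, 'k) mpoly"
    using minus_equality[of "- b" b] that by (simp add: a_minus_def mpoly_ring_closed)
  note coeffs = f[unfolded mem_mpoly_poly_ring_iff, rule_format]
    g[unfolded mem_mpoly_poly_ring_iff, rule_format]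
  have "?E f i = ?E g i \<longleftrightarrow> (\<exists>a\<in>carrier (mpoly_ring V). poly.coeff (f - g) i = F * a)" for i
  proof -
    have "?E f i = ?E g i \<longleftrightarrow>
        poly.coeff f i \<ominus>\<^bsub>mpoly_ring V\<^esub> poly.coeff g i \<in> PIdl\<^bsub>mpoly_ring V\<^esub> F"
      unfolding quotient_poly_def
      by (rule quotient_eq_iff_same_a_r_cos[OF I, symmetric]) (rule coeffs)+
    also have "\<dots> \<longleftrightarrow> (\<exists>a\<in>carrier (mpoly_ring V). poly.coeff (f - g) i = F * a)"
      by (auto simp: minus coeffs cgenideal_def mult.commute)
    finally show ?thesis .
  qed
  then have "?E f = ?E g \<longleftrightarrow>
      (\<forall>i. \<exists>a\<in>carrier (mpoly_ring V). poly.coeff (f - g) i = F * a)"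
    by (simp add: fun_eq_iff)
  also have "\<dots> \<longleftrightarrow> ?R"
  proof
    assume *: "\<forall>i. \<exists>a\<in>carrier (mpoly_ring V). poly.coeff (f - g) i = F * a"
    \<comment> \<open>The cofactors are chosen as \<open>0\<close> above the degree; together they
      then form a polynomial.\<close>
    have "\<exists>a\<in>carrier (mpoly_ring V). poly.coeff (f - g) i = F * a \<and> (degree (f - g) < i \<longrightarrow> a = 0)"
      for i
      using * coeff_eq_0[of "f - g" i]
      by (cases "degree (f - g) < i") (auto intro: mpoly_ring_closed intro!: bexI[of _ 0])
    then obtain d where d: "\<And>i. d i \<in> carrier (mpoly_ring V)"
        "\<And>i. poly.coeff (f - g) i = F * d i" "\<And>i. degree (f - g) < i \<Longrightarrow> d i = 0"
      by metis
    obtain h where "h \<in> carrier (mpoly_poly_ring V)" "\<And>i. poly.coeff h i = d i"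
      using exists_mpoly_poly_with_coeffs[of d V "degree (f - g)"] d by blast
    moreover from this(2) have "f - g = [:F:] * h"
      by (intro poly_eqI) (simp add: d(2)[simplified])
    ultimately show ?R by blast
  next
    assume ?R
    then obtain d where "d \<in> carrier (mpoly_poly_ring V)" "f - g = [:F:] * d" ..
    then show "\<forall>i. \<exists>a\<in>carrier (mpoly_ring V). poly.coeff (f - g) i = F * a"
      by (auto simp: mem_mpoly_poly_ring_iff simp del: coeff_diff)
  qed
  finally show ?thesis .
qed

text \<open>\<open>A\<close> and \<open>A'\<close> are quotients of \<open>P\<close> via
  \<open>E\<close> and \<open>E'\<close>. Endomorphisms of \<open>P\<close> that respect the kernels
  descend, and it suffices that they are mutually inverse modulo the kernels.\<close>

lemma ring_iso_between_quotients:
  assumes E: "E \<in> ring_hom P A" "E ` carrier P = carrier A"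
    and E': "E' \<in> ring_hom P A'" "E' ` carrier P = carrier A'"
    and P: "ring P"
    and f: "f \<in> ring_hom P P" and g: "g \<in> ring_hom P P"
    and f_cong: "\<And>x y. x \<in> carrier P \<Longrightarrow> y \<in> carrier P \<Longrightarrow> E x = E y \<Longrightarrow> E' (f x) = E' (f y)"
    and g_cong: "\<And>x y. x \<in> carrier P \<Longrightarrow> y \<in> carrier P \<Longrightarrow> E' x = E' y \<Longrightarrow> E (g x) = E (g y)"
    and gf: "\<And>x. x \<in> carrier P \<Longrightarrow> E (g (f x)) = E x"
    and fg: "\<And>x. x \<in> carrier P \<Longrightarrow> E' (f (g x)) = E' x"
  shows "\<exists>h \<in> ring_iso A A'. \<forall>x\<in>carrier P. h (E x) = E' (f x)"
proof -
  interpret ring P by (rule P)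
  \<comment> \<open>\<open>f\<close> is applied to an arbitrary preimage; \<open>f_cong\<close>
    makes the value independent of the choice.\<close>
  define h where "h \<alpha> = E' (f (SOME x. x \<in> carrier P \<and> E x = \<alpha>))" for \<alpha>
  have h: "h (E x) = E' (f x)" if "x \<in> carrier P" for x
  proof -
    have "(SOME y. y \<in> carrier P \<and> E y = E x) \<in> carrier P \<and>
        E (SOME y. y \<in> carrier P \<and> E y = E x) = E x"
      using that by (intro someI[of "\<lambda>y. y \<in> carrier P \<and> E y = E x"]) auto
    then show ?thesis unfolding h_def by (intro f_cong that) auto
  qed
  have lift: "\<exists>x\<in>carrier P. \<alpha> = E x" if "\<alpha> \<in> carrier A" for \<alpha>
    using that E(2) by auto
  have hom: "h \<in> ring_hom A A'"
  proof (rule ring_hom_memI)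
    fix \<alpha> \<beta> assume "\<alpha> \<in> carrier A" "\<beta> \<in> carrier A"
    then obtain x y where xy: "x \<in> carrier P" "\<alpha> = E x" "y \<in> carrier P" "\<beta> = E y"
      using lift by blast
    show "h \<alpha> \<in> carrier A'"
      using xy ring_hom_closed[OF f] ring_hom_closed[OF E'(1)] by (simp add: h)
    show "h (\<alpha> \<otimes>\<^bsub>A\<^esub> \<beta>) = h \<alpha> \<otimes>\<^bsub>A'\<^esub> h \<beta>"
      using xy ring_hom_mult[OF f] ring_hom_closed[OF f]
      by (simp add: h flip: ring_hom_mult[OF E(1)] ring_hom_mult[OF E'(1)])
    show "h (\<alpha> \<oplus>\<^bsub>A\<^esub> \<beta>) = h \<alpha> \<oplus>\<^bsub>A'\<^esub> h \<beta>"
      using xy ring_hom_add[OF f] ring_hom_closed[OF f]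
      by (simp add: h flip: ring_hom_add[OF E(1)] ring_hom_add[OF E'(1)])
  next
    show "h \<one>\<^bsub>A\<^esub> = \<one>\<^bsub>A'\<^esub>"
      using h[OF one_closed] by (simp add: ring_hom_one[OF E(1)] ring_hom_one[OF E'(1)] ring_hom_one[OF f])
  qed
  have "inj_on h (carrier A)"
  proof (rule inj_onI)
    fix \<alpha> \<beta> assume "\<alpha> \<in> carrier A" "\<beta> \<in> carrier A" and eq: "h \<alpha> = h \<beta>"
    then obtain x y where xy: "x \<in> carrier P" "\<alpha> = E x" "y \<in> carrier P" "\<beta> = E y"
      using lift by blast
    then have "E (g (f x)) = E (g (f y))"
      using eq by (intro g_cong ring_hom_closed[OF f]) (simp_all add: h)
    then show "\<alpha> = \<beta>" using xy by (simp add: gf)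
  qed
  moreover have "h ` carrier A = carrier A'"
  proof
    show "h ` carrier A \<subseteq> carrier A'"
      using ring_hom_closed[OF hom] by blast
    show "carrier A' \<subseteq> h ` carrier A"
    proof
      fix \<alpha> assume "\<alpha> \<in> carrier A'"
      then obtain x where x: "x \<in> carrier P" "\<alpha> = E' x" using E'(2) by blast
      then have "\<alpha> = h (E (g x))"
        using ring_hom_closed[OF g] by (simp add: h fg)
      then show "\<alpha> \<in> h ` carrier A"
        using x ring_hom_closed[OF g] ring_hom_closed[OF E(1)] by blast
    qed
  qed
  ultimately have "h \<in> ring_iso A A'"
    using hom by (simp add: ring_iso_def bij_betw_def)
  with h show ?thesis by blast
qed

subsection \<open>Roots and inverses modulo powers of the variable\<close>

lemma X_dvd_iff: "[:0, 1:] dvd (f :: 'k::comm_ring_1 poly) \<longleftrightarrow> poly f 0 = 0"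
  using poly_eq_0_iff_dvd[of f 0] by simp

text \<open>The first-order Taylor expansion of a power, as needed for a Newton step.\<close>

lemma power_add_second_order:
  fixes x y :: "'a::comm_ring_1"
  shows "\<exists>z. (x + y) ^ K = x ^ K + of_nat K * x ^ (K - 1) * y + y ^ 2 * z"
proof (induction K)
  case 0
  show ?case by (rule exI[of _ 0]) simp
next
  case (Suc K)
  then obtain z where z: "(x + y) ^ K = x ^ K + of_nat K * x ^ (K - 1) * y + y ^ 2 * z" ..
  \<comment> \<open>At \<open>K = 0\<close> the subtraction \<open>K - 1\<close> is truncated, but
    the factor \<open>of_nat K\<close> makes both sides vanish.\<close>
  have *: "of_nat K * x ^ (K - 1) * x = of_nat K * x ^ K"
    by (cases K) (simp_all add: mult_ac)
  have "(x + y) ^ Suc K = x ^ Suc K + x ^ K * y + (of_nat K * x ^ (K - 1) * x) * y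
      + y ^ 2 * (of_nat K * x ^ (K - 1) + z * (x + y))"
    by (simp add: z algebra_simps power2_eq_square)
  also have "\<dots> = x ^ Suc K + of_nat (Suc K) * x ^ (Suc K - 1) * y
      + y ^ 2 * (of_nat K * x ^ (K - 1) + z * (x + y))"
    unfolding * by (simp add: algebra_simps)
  finally show ?case ..
qed

text \<open>Newton iteration starting at \<open>1\<close>: each step adds a scalar multiple of
  \<open>X ^ Suc N\<close> and gains one power of \<open>X\<close>. Characteristic zero allows the
  division by \<open>K\<close>.\<close>

lemma poly_root_mod_X_power:
  fixes g :: "'k::field_char_0 poly"
  assumes "poly g 0 = 1" "K > 0"
  shows "\<exists>\<nu>. poly \<nu> 0 = 1 \<and> [:0, 1:] ^ Suc N dvd \<nu> ^ K - g"
proof (induction N)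
  case 0
  show ?case by (rule exI[of _ 1]) (simp add: assms X_dvd_iff)
next
  case (Suc N)
  then obtain \<nu> h where \<nu>: "poly \<nu> 0 = 1" and h: "\<nu> ^ K - g = [:0, 1:] ^ Suc N * h"
    by (auto elim: dvdE)
  \<comment> \<open>Solves \<open>h(0) + K a = 0\<close>, where \<open>\<nu>(0) = 1\<close> is used;
    the linear part of the error then gains a factor \<open>X\<close>.\<close>
  define a where "a = - poly h 0 / of_nat K"
  define y where "y = [:0, 1:] ^ Suc N * [:a:]"
  obtain z where z: "(\<nu> + y) ^ K = \<nu> ^ K + of_nat K * \<nu> ^ (K - 1) * y + y ^ 2 * z"
    using power_add_second_order by blast
  have "poly (h + of_nat K * \<nu> ^ (K - 1) * [:a:]) 0 = 0"
    using \<nu> assms(2) by (simp add: a_def poly_power)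
  then have "[:0, 1:] dvd h + of_nat K * \<nu> ^ (K - 1) * [:a:]"
    by (simp only: X_dvd_iff)
  then have "[:0, 1:] ^ Suc N * [:0, 1:] dvd
      [:0, 1:] ^ Suc N * (h + of_nat K * \<nu> ^ (K - 1) * [:a:])"
    by (rule mult_dvd_mono[OF dvd_refl])
  \<comment> \<open>The square \<open>y ^ 2\<close> carries \<open>X ^ (2 * Suc N)\<close>, which
    contains \<open>X ^ Suc N * X\<close> because the exponent \<open>Suc N\<close> is
    positive.\<close>
  moreover have "[:0, 1:] ^ Suc N * [:0, 1:] dvd y ^ 2 * z"
    unfolding y_def power2_eq_square
    by (intro dvd_mult2 mult_dvd_mono dvd_triv_left dvd_power) simp_all
  ultimately have "[:0, 1:] ^ Suc N * [:0, 1:] dvd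
      [:0, 1:] ^ Suc N * (h + of_nat K * \<nu> ^ (K - 1) * [:a:]) + y ^ 2 * z"
    by (rule dvd_add)
  also have "[:0, 1:] ^ Suc N * (h + of_nat K * \<nu> ^ (K - 1) * [:a:]) + y ^ 2 * z = (\<nu> + y) ^ K - g"
    unfolding z using h by (simp only: y_def algebra_simps)
  finally have "[:0, 1:] ^ Suc (Suc N) dvd (\<nu> + y) ^ K - g"
    by (simp only: power_Suc2)
  moreover have "poly (\<nu> + y) 0 = 1"
    using \<nu> by (simp add: y_def)
  ultimately show ?case by blast
qed

text \<open>A truncated geometric series: \<open>f\<close> divides \<open>1 - (1 - f) ^ N\<close>,
  and \<open>X\<close> divides \<open>1 - f\<close>.\<close>

lemma poly_inverse_mod_X_power:
  fixes f :: "'k::field poly"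
  assumes "poly f 0 = 1"
  shows "\<exists>g. [:0, 1:] ^ N dvd f * g - 1"
proof -
  have "1 - (1 - f) dvd 1 - (1 - f) ^ N"
    using power_diff_sumr2[of 1 N "1 - f"] by simp
  then obtain g where "1 - (1 - f) ^ N = f * g" by (auto elim: dvdE)
  then have "f * g - 1 = - ((1 - f) ^ N)" by (simp add: algebra_simps)
  moreover have "[:0, 1:] ^ N dvd (1 - f) ^ N"
    using assms by (intro dvd_power_same) (simp add: X_dvd_iff)
  ultimately have "[:0, 1:] ^ N dvd f * g - 1" by simp
  then show ?thesis ..
qed

text \<open>
  Requiring \<open>\<nu>\<^sup>K p'(u) = c p(c u)\<close> at \<open>u = 0\<close> with \<open>\<nu> = 1\<close> forces \<open>c = p'(0) / p(0)\<close>.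
\<close>

lemma exists_rescaling_data:
  fixes p p' :: "'k::field_char_0 poly"
  assumes "poly p 0 \<noteq> 0" "poly p' 0 \<noteq> 0" "K > 0"
  obtains c \<nu> \<mu> where "c \<noteq> 0" "[:0, 1:] ^ N dvd \<nu> * \<mu> - 1"
    "[:0, 1:] ^ N dvd \<nu> ^ K * p' - smult c (pcompose p [:0, c:])"
proof -
  define c where "c = poly p' 0 / poly p 0"
  \<comment> \<open>Dividing both sides of the required congruence by \<open>p'(0)\<close> gives
    \<open>p1\<close> and \<open>t\<close> constant term \<open>1\<close>. With \<open>s\<close>
    inverse to \<open>p1\<close>, it remains to take a \<open>K\<close>-th root of
    \<open>t * s\<close>.\<close>
  define p1 where "p1 = smult (1 / poly p' 0) p'"
  define t where "t = smult (c / poly p' 0) (pcompose p [:0, c:])"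
  have "poly p1 0 = 1" using assms by (simp add: p1_def)
  \<comment> \<open>\<open>Suc N\<close> instead of \<open>N\<close> keeps the exponent positive, so
    that \<open>s(0) = 1\<close> follows even for \<open>N = 0\<close>.\<close>
  then obtain s where s: "[:0, 1:] ^ Suc N dvd p1 * s - 1"
    using poly_inverse_mod_X_power by blast
  then have "[:0, 1:] dvd p1 * s - 1"
    by (metis dvd_trans dvd_triv_left power_Suc)
  then have s0: "poly s 0 = 1"
    using \<open>poly p1 0 = 1\<close> by (simp add: X_dvd_iff)
  have "poly (t * s) 0 = 1"
    using assms by (simp add: t_def c_def s0 poly_pcompose)
  then obtain \<nu> where \<nu>: "poly \<nu> 0 = 1" "[:0, 1:] ^ Suc N dvd \<nu> ^ K - t * s"
    using poly_root_mod_X_power assms(3) by blast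
  obtain \<mu> where \<mu>: "[:0, 1:] ^ N dvd \<nu> * \<mu> - 1"
    using poly_inverse_mod_X_power[OF \<nu>(1)] by blast
  have "([:0, 1:] :: 'k poly) ^ N dvd [:0, 1:] ^ Suc N" for N :: nat
    by (rule le_imp_power_dvd) simp
  note dvd = dvd_trans[OF this]
  have p': "p' = smult (poly p' 0) p1" using assms by (simp add: p1_def)
  have "\<nu> ^ K * p' - smult c (pcompose p [:0, c:]) =
      (\<nu> ^ K - t * s) * p' + smult (poly p' 0) t * (p1 * s - 1)"
    by (subst (1 2) p') (simp add: t_def assms algebra_simps smult_diff_right)
  also have "[:0, 1:] ^ N dvd \<dots>"
    by (intro dvd_add dvd_mult dvd_mult2 dvd[OF \<nu>(2)] dvd[OF s])
  finally have "[:0, 1:] ^ N dvd \<nu> ^ K * p' - smult c (pcompose p [:0, c:])" .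
  moreover have "c \<noteq> 0" using assms by (simp add: c_def)
  ultimately show ?thesis using that \<mu> by blast
qed

subsection \<open>Homomorphisms out of the cylinder\<close>

text \<open>Constants, the variables in \<open>V\<close> and the extra variable generate the
  cylinder, so closure and congruences need checking on generators only.\<close>

lemma mpoly_poly_ring_induct [consumes 1, case_names Const Var X add mult]:
  assumes "g \<in> carrier (mpoly_poly_ring V)"
    and "\<And>c. P [:Const c:]" and "\<And>v. v \<in> V \<Longrightarrow> P [:Var v:]" and "P [:0, 1:]"
    and add: "\<And>f g. P f \<Longrightarrow> P g \<Longrightarrow> P (f + g)" and mult: "\<And>f g. P f \<Longrightarrow> P g \<Longrightarrow> P (f * g)"
  shows "P g"
  using assms(1)
proof (induction g)
  case 0
  then show ?case using assms(2)[of 0] by (simp add: Const_def)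
next
  case (pCons a g)
  have coeffs: "poly.coeff (pCons a g) i \<in> carrier (mpoly_ring V)" for i
    using pCons.prems by (simp add: mem_mpoly_poly_ring_iff)
  have "a \<in> carrier (mpoly_ring V)" using coeffs[of 0] by simp
  then have "P [:a:]"
    by (induction a rule: mpoly_ring_induct) (use assms(2-3) add mult in fastforce)+
  moreover have "g \<in> carrier (mpoly_poly_ring V)"
    unfolding mem_mpoly_poly_ring_iff using coeffs[of "Suc _"] by simp
  then have "P g" by (rule pCons.IH)
  ultimately have "P ([:a:] + [:0, 1:] * g)"
    by (intro add mult assms(4))
  then show ?case by simp
qed

lemma ring_homomorphism_const: "ring_homomorphism (\<lambda>c. [:Const c:])"
  by (rule ring_homomorphism_comp[OF ring_homomorphism_const_poly ring_homomorphism_Const])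

text \<open>Substitution of \<open>e v\<close> for the variables and of \<open>w\<close> for the
  extra variable; the isomorphism and its inverse are induced by maps of this form.\<close>

definition poly_lift ::
    "('v \<Rightarrow> ('v, 'k::comm_ring_1) mpoly poly) \<Rightarrow> ('v, 'k) mpoly poly \<Rightarrow>
     ('v, 'k) mpoly poly \<Rightarrow> ('v, 'k) mpoly poly"
  where "poly_lift e w g = poly (map_poly (mpoly_eval (\<lambda>c. [:Const c:]) e) g) w"

lemma ring_homomorphism_poly_lift: "ring_homomorphism (poly_lift e w)"
  using ring_homomorphism.poly_map_poly_hom[OF ring_homomorphism_mpoly_eval[OF ring_homomorphism_const]]
  by (simp add: poly_lift_def[abs_def])

lemma poly_lift_simps:
  "poly_lift e w [:Const c:] = [:Const c:]" "poly_lift e w [:Var v:] = e v"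
  "poly_lift e w [:0, 1:] = w"
proof -
  interpret ev: ring_homomorphism "mpoly_eval (\<lambda>c. [:Const c:]) e"
    by (rule ring_homomorphism_mpoly_eval[OF ring_homomorphism_const])
  show "poly_lift e w [:Const c:] = [:Const c:]" "poly_lift e w [:Var v:] = e v"
    "poly_lift e w [:0, 1:] = w"
    by (simp_all add: poly_lift_def map_poly_pCons ev.hom_zero ev.hom_one
        mpoly_eval_Const[OF ring_homomorphism_const] mpoly_eval_Var[OF ring_homomorphism_const])
qed

lemma ring_homomorphism_closed:
  assumes h: "ring_homomorphism h" and g: "g \<in> carrier (mpoly_poly_ring V)"
    and "\<And>c. h [:Const c:] \<in> carrier (mpoly_poly_ring V')"
    and "\<And>v. v \<in> V \<Longrightarrow> h [:Var v:] \<in> carrier (mpoly_poly_ring V')"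
    and "h [:0, 1:] \<in> carrier (mpoly_poly_ring V')"
  shows "h g \<in> carrier (mpoly_poly_ring V')"
  using g by (induction g rule: mpoly_poly_ring_induct)
    (auto simp: assms ring_homomorphism.hom_add[OF h] ring_homomorphism.hom_mult[OF h]
      intro: mpoly_poly_ring_closed)

text \<open>Congruence inside the subring: the cofactor must not involve variables outside
  \<open>V\<close>.\<close>

definition cong_mod ::
    "'v set \<Rightarrow> ('v, 'k::comm_ring_1) mpoly poly \<Rightarrow> ('v, 'k) mpoly poly \<Rightarrow> ('v, 'k) mpoly poly \<Rightarrow> bool"
  where "cong_mod V M f g \<longleftrightarrow> (\<exists>d\<in>carrier (mpoly_poly_ring V). f - g = M * d)"

lemma cong_mod_refl: "cong_mod V M f f"
  by (auto simp: cong_mod_def intro!: bexI[of _ 0] mpoly_poly_ring_closed)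

lemma cong_mod_trans [trans]: "cong_mod V M f g \<Longrightarrow> cong_mod V M g h \<Longrightarrow> cong_mod V M f h"
  unfolding cong_mod_def
proof safe
  fix d d' assume "d \<in> carrier (mpoly_poly_ring V)" "d' \<in> carrier (mpoly_poly_ring V)"
    and *: "f - g = M * d" "g - h = M * d'"
  moreover have "f - h = (f - g) + (g - h)" by simp
  then have "f - h = M * (d + d')" unfolding * by (simp only: distrib_left)
  ultimately show "\<exists>d\<in>carrier (mpoly_poly_ring V). f - h = M * d"
    by (blast intro: mpoly_poly_ring_closed)
qed

lemma cong_mod_add:
  "cong_mod V M f g \<Longrightarrow> cong_mod V M f' g' \<Longrightarrow> cong_mod V M (f + f') (g + g')"
  unfolding cong_mod_def
proof safe
  fix d d' assume "d \<in> carrier (mpoly_poly_ring V)" "d' \<in> carrier (mpoly_poly_ring V)"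
    and *: "f - g = M * d" "f' - g' = M * d'"
  moreover have "f + f' - (g + g') = (f - g) + (f' - g')" by simp
  then have "f + f' - (g + g') = M * (d + d')" unfolding * by (simp only: distrib_left)
  ultimately show "\<exists>d\<in>carrier (mpoly_poly_ring V). f + f' - (g + g') = M * d"
    by (blast intro: mpoly_poly_ring_closed)
qed

lemma cong_mod_mult:
  assumes "f \<in> carrier (mpoly_poly_ring V)" "g' \<in> carrier (mpoly_poly_ring V)"
    and "cong_mod V M f g" "cong_mod V M f' g'"
  shows "cong_mod V M (f * f') (g * g')"
proof -
  obtain d d' where d: "d \<in> carrier (mpoly_poly_ring V)" "d' \<in> carrier (mpoly_poly_ring V)"
    and *: "f - g = M * d" "f' - g' = M * d'"
    using assms(3,4) unfolding cong_mod_def by blast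
  have "f * f' - g * g' = f * (f' - g') + (f - g) * g'" by (simp add: algebra_simps)
  also have "\<dots> = M * (f * d' + d * g')" unfolding * by (simp add: algebra_simps)
  finally show ?thesis
    unfolding cong_mod_def using assms(1,2) d by (blast intro: mpoly_poly_ring_closed)
qed

lemma cong_mod_power:
  assumes "f \<in> carrier (mpoly_poly_ring V)" "g \<in> carrier (mpoly_poly_ring V)" "cong_mod V M f g"
  shows "cong_mod V M (f ^ j) (g ^ j)"
  by (induction j)
    (auto intro: cong_mod_refl cong_mod_mult assms mpoly_poly_ring_power_closed)

lemma const_poly_closed: "[:Const c:] \<in> carrier (mpoly_poly_ring V)"
  by (intro mpoly_poly_ring_closed mpoly_ring_closed)

lemma X_closed: "[:0, 1:] \<in> carrier (mpoly_poly_ring V)"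
  by (auto simp: mem_mpoly_poly_ring_iff coeff_pCons split: nat.splits intro: mpoly_ring_closed)

lemma Var_poly_closed: "v \<in> V \<Longrightarrow> [:Var v:] \<in> carrier (mpoly_poly_ring V)"
  by (intro mpoly_poly_ring_closed mpoly_ring_closed)

lemma ring_homomorphism_cong_ident:
  assumes h: "ring_homomorphism h" and g: "g \<in> carrier (mpoly_poly_ring V)"
    and closed: "\<And>g. g \<in> carrier (mpoly_poly_ring V) \<Longrightarrow> h g \<in> carrier (mpoly_poly_ring V)"
    and "\<And>c. cong_mod V M (h [:Const c:]) [:Const c:]"
    and "\<And>v. v \<in> V \<Longrightarrow> cong_mod V M (h [:Var v:]) [:Var v:]"
    and "cong_mod V M (h [:0, 1:]) [:0, 1:]"
  shows "cong_mod V M (h g) g"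
proof -
  \<comment> \<open>Membership of \<open>g\<close> is part of the induction because
    \<open>cong_mod_mult\<close> asks for it.\<close>
  have "g \<in> carrier (mpoly_poly_ring V) \<and> cong_mod V M (h g) g"
    using g by (induction g rule: mpoly_poly_ring_induct)
      (auto simp: assms ring_homomorphism.hom_add[OF h] ring_homomorphism.hom_mult[OF h]
        const_poly_closed X_closed
        intro: mpoly_poly_ring_closed Var_poly_closed cong_mod_add cong_mod_mult closed)
  then show ?thesis ..
qed

section \<open>Rescaling the variable of \<open>k[u]\<close>\<close>

lemma pcompose_rescale_inverse:
  fixes f :: "'k::field poly"
  assumes "c \<noteq> 0"
  shows "pcompose (pcompose f [:0, c:]) [:0, inverse c:] = f"
    and "pcompose (pcompose f [:0, inverse c:]) [:0, c:] = f"
  using assms by (simp_all flip: pcompose_assoc add: pcompose_pCons)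

lemma ring_homomorphism_pcompose: "ring_homomorphism (\<lambda>f. pcompose f h)"
  by (simp add: ring_homomorphism_def pcompose_add pcompose_mult pcompose_1)

lemma X_power_dvd_pcompose:
  fixes f :: "'k::field poly"
  assumes "[:0, 1:] ^ N dvd f"
  shows "[:0, 1:] ^ N dvd pcompose f [:0, c:]"
proof -
  obtain g where "f = [:0, 1:] ^ N * g" using assms by (auto elim: dvdE)
  moreover have "pcompose [:0, 1:] [:0, c:] = [:0, 1:] * [:c:]"
    by (simp add: pcompose_pCons)
  ultimately show ?thesis
    by (simp only: pcompose_mult ring_homomorphism.hom_power[OF ring_homomorphism_pcompose]
        power_mult_distrib mult.assoc dvd_triv_left)
qed

lemma diff_dvd_power_diff: "(x - y :: 'a::comm_ring_1) dvd x ^ j - y ^ j"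
  using power_diff_sumr2[of x j y] by simp

text \<open>
  Modulo \<open>X\<^sup>N\<close> the rescaling of \<open>(z, t)\<close> by \<open>(\<nu>\<^sup>r, \<nu>\<^sup>q)\<close> multiplies \<open>z\<^sup>q + t\<^sup>r\<close> by \<open>l = \<nu>\<^sup>q\<^sup>r\<close>.
  If \<open>\<nu>\<mu> \<equiv> 1\<close>, then with \<open>e = 1 - \<nu>\<^sup>r\<mu>\<^sup>r\<close> and \<open>a' = \<mu>\<^sup>r(1 + e)\<close> the matrix with rows \<open>(\<nu>\<^sup>r, -e)\<close>
  and \<open>(e, a')\<close> has determinant \<open>1\<close> and lifts \<open>diag(\<nu>\<^sup>r, \<mu>\<^sup>r)\<close>; likewise for \<open>\<nu>\<^sup>q\<close>.
\<close>

lemma exists_twist_data: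
  fixes p p' :: "'k::field_char_0 poly"
  assumes "poly p 0 \<noteq> 0" "poly p' 0 \<noteq> 0" "q > 0" "r > 0"
  obtains c a a' e b b' f l l' where "c \<noteq> 0" "a * a' + e\<^sup>2 = 1" "b * b' + f\<^sup>2 = 1"
    "[:0, 1:] ^ N dvd e" "[:0, 1:] ^ N dvd f" "[:0, 1:] ^ N dvd l * l' - 1"
    "a ^ q = l" "b ^ r = l" "[:0, 1:] ^ N dvd a' ^ q - l'" "[:0, 1:] ^ N dvd b' ^ r - l'"
    "[:0, 1:] ^ N dvd l * p' - smult c (pcompose p [:0, c:])"
proof -
  obtain c \<nu> \<mu> where c: "c \<noteq> 0" and inv: "[:0, 1:] ^ N dvd \<nu> * \<mu> - 1"
    and rescale: "[:0, 1:] ^ N dvd \<nu> ^ (q * r) * p' - smult c (pcompose p [:0, c:])"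
    using exists_rescaling_data[OF assms(1,2), of "q * r" N] assms(3,4) by (metis nat_0_less_mult_iff)
  define e where "e j = 1 - \<nu> ^ j * \<mu> ^ j" for j
  have e: "[:0, 1:] ^ N dvd e j" for j
  proof -
    have "\<nu> * \<mu> - 1 dvd (\<nu> * \<mu>) ^ j - 1 ^ j" by (rule diff_dvd_power_diff)
    then have "[:0, 1:] ^ N dvd - ((\<nu> * \<mu>) ^ j - 1 ^ j)"
      using inv dvd_trans dvd_minus_iff by blast
    then show ?thesis by (simp add: e_def power_mult_distrib)
  qed
  have det: "\<nu> ^ j * (\<mu> ^ j * (1 + e j)) + (e j)\<^sup>2 = 1" for j
  proof -
    have "\<nu> ^ j * \<mu> ^ j = 1 - e j" by (simp add: e_def)
    then have "\<nu> ^ j * (\<mu> ^ j * (1 + e j)) = (1 - e j) * (1 + e j)"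
      by (simp only: mult.assoc[symmetric])
    then show ?thesis by (simp add: algebra_simps power2_eq_square)
  qed
  \<comment> \<open>\<open>1 + e j\<close> is congruent to \<open>1\<close>, so this correcting
    factor disappears modulo \<open>X ^ N\<close>.\<close>
  have pow: "[:0, 1:] ^ N dvd (\<mu> ^ j * (1 + e j)) ^ i - \<mu> ^ (j * i)" for i j
  proof -
    have "1 + e j - 1 dvd (1 + e j) ^ i - 1 ^ i" by (rule diff_dvd_power_diff)
    then have "[:0, 1:] ^ N dvd \<mu> ^ (j * i) * ((1 + e j) ^ i - 1)"
      using e[of j] dvd_trans by (intro dvd_mult) auto
    then show ?thesis
      by (simp add: power_mult_distrib right_diff_distrib flip: power_mult)
  qed
  have l: "[:0, 1:] ^ N dvd \<nu> ^ (q * r) * \<mu> ^ (q * r) - 1"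
    using e[of "q * r"] unfolding e_def by (subst dvd_minus_iff[symmetric]) simp
  show ?thesis
  proof (rule that[of c "\<nu> ^ r" "\<mu> ^ r * (1 + e r)" "e r" "\<nu> ^ q" "\<mu> ^ q * (1 + e q)" "e q"
        "\<nu> ^ (q * r)" "\<mu> ^ (q * r)"])
  qed (use c det e l pow[of r q] pow[of q r] rescale in
      \<open>simp_all add: mult.commute flip: power_mult\<close>)
qed

subsection \<open>The cylinder over the hypersurface\<close>

text \<open>\<open>N\<close> bounds the exponents, so \<open>M\<close> divides \<open>U ^ N\<close>,
  and a congruence modulo \<open>u ^ N\<close> in \<open>k[u]\<close> becomes one modulo
  \<open>M\<close> in the cylinder.\<close>

locale cylinder =
  fixes m :: nat and n :: "nat \<Rightarrow> nat" and q r N :: nat and P :: "(var, 'k::field_char_0) mpoly poly set"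
  assumes n_le: "\<And>i. i \<le> m \<Longrightarrow> n i \<le> N"
    and P_def: "P = carrier (mpoly_poly_ring (ambient_vars m))"
begin

abbreviation scal :: "'k \<Rightarrow> (var, 'k) mpoly poly" where "scal c \<equiv> [:Const c:]"
abbreviation var :: "var \<Rightarrow> (var, 'k) mpoly poly" where "var v \<equiv> [:Var v:]"
abbreviation W :: "(var, 'k) mpoly poly" where "W \<equiv> [:0, 1:]"
abbreviation F :: "'k poly \<Rightarrow> (var, 'k) mpoly poly" where "F p \<equiv> [:relator m n q r p:]"

definition U :: "(var, 'k) mpoly poly" where "U = (\<Prod>i\<le>m. var (VX i))"
definition M :: "(var, 'k) mpoly poly" where "M = (\<Prod>i\<le>m. var (VX i) ^ n i)"
definition at_U :: "'k poly \<Rightarrow> (var, 'k) mpoly poly" where "at_U f = poly (map_poly scal f) U"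

abbreviation congM (infix "\<simeq>" 50) where "congM \<equiv> cong_mod (ambient_vars m) M"

section \<open>Closure, and congruences modulo \<open>M\<close>\<close>

lemma closed:
  "0 \<in> P" "1 \<in> P" "f \<in> P \<Longrightarrow> g \<in> P \<Longrightarrow> f + g \<in> P" "f \<in> P \<Longrightarrow> g \<in> P \<Longrightarrow> f - g \<in> P"
  "f \<in> P \<Longrightarrow> g \<in> P \<Longrightarrow> f * g \<in> P" "f \<in> P \<Longrightarrow> - f \<in> P" "f \<in> P \<Longrightarrow> f ^ j \<in> P"
  "scal c \<in> P" "W \<in> P"
  unfolding P_def
  by (simp_all add: mpoly_poly_ring_closed mpoly_poly_ring_power_closed const_poly_closed X_closed)

lemma congM_iff: "f \<simeq> g \<longleftrightarrow> (\<exists>d\<in>P. f - g = M * d)"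
  by (simp add: cong_mod_def P_def)

lemma congM_E: "f \<simeq> g \<Longrightarrow> \<exists>d\<in>P. f = g + M * d"
  by (simp only: congM_iff diff_eq_eq add.commute)

lemma congM_mult: "f \<in> P \<Longrightarrow> g' \<in> P \<Longrightarrow> f \<simeq> g \<Longrightarrow> f' \<simeq> g' \<Longrightarrow> f * f' \<simeq> g * g'"
  unfolding P_def by (rule cong_mod_mult)

lemma congM_power: "f \<in> P \<Longrightarrow> g \<in> P \<Longrightarrow> f \<simeq> g \<Longrightarrow> f ^ j \<simeq> g ^ j"
  unfolding P_def by (rule cong_mod_power)

lemma prod_closed: "(\<And>i. i \<in> I \<Longrightarrow> g i \<in> P) \<Longrightarrow> prod g I \<in> P"
  by (induction I rule: infinite_finite_induct) (auto intro: closed)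

lemma var_closed: "i \<le> m \<Longrightarrow> var (VX i) \<in> P" "var VY \<in> P" "var VZ \<in> P" "var VT \<in> P"
  unfolding P_def by (auto intro!: Var_poly_closed simp: ambient_vars_def)

sublocale scal: ring_homomorphism scal
  by (rule ring_homomorphism_const)

sublocale at_U: ring_homomorphism at_U
  using scal.poly_map_poly_hom by (simp add: at_U_def[abs_def])

lemma at_U_pCons: "at_U (pCons a f) = scal a + U * at_U f"
  by (simp add: at_U_def map_poly_pCons scal.hom_zero)

lemma at_U_smult: "at_U (smult c f) = scal c * at_U f"
  by (simp add: at_U_def map_poly_smult scal.hom_zero scal.hom_mult)

lemma at_U_X_power: "at_U ([:0, 1:] ^ j) = U ^ j"
  by (simp add: at_U.hom_power at_U_pCons scal.hom_zero scal.hom_one at_U.hom_zero)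

lemma U_closed: "U \<in> P"
  unfolding U_def by (intro prod_closed var_closed) auto

lemma at_U_closed: "at_U f \<in> P"
  by (induction f) (simp_all add: at_U_pCons at_U.hom_zero closed U_closed)

lemma U_power_eq: "\<exists>d\<in>P. U ^ N = M * d"
proof (rule bexI)
  show "(\<Prod>i\<le>m. var (VX i) ^ (N - n i)) \<in> P"
    by (intro prod_closed closed var_closed) auto
  show "U ^ N = M * (\<Prod>i\<le>m. var (VX i) ^ (N - n i))"
    unfolding U_def M_def prod_power_distrib prod.distrib[symmetric]
    by (intro prod.cong) (simp_all add: n_le flip: power_add)
qed

lemma congM_at_U:
  assumes "[:0, 1:] ^ N dvd f - g"
  shows "at_U f \<simeq> at_U g"
proof -
  obtain h where "f - g = [:0, 1:] ^ N * h" using assms by (auto elim: dvdE)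
  then have "at_U f - at_U g = U ^ N * at_U h"
    by (simp only: at_U.hom_diff[symmetric] at_U.hom_mult at_U_X_power)
  moreover obtain d where "d \<in> P" "U ^ N = M * d" using U_power_eq ..
  ultimately show ?thesis
    unfolding congM_iff by (intro bexI[of _ "d * at_U h"] closed at_U_closed) (simp only: mult.assoc)
qed

lemma relator_eq: "F p = M * var VY + var VZ ^ q + var VT ^ r + var (VX 0) * at_U p"
proof -
  interpret const: ring_homomorphism "\<lambda>c :: (var, 'k) mpoly. [:c:]"
    by (rule ring_homomorphism_const_poly)
  have "[:poly (map_poly Const p) x:] = poly (map_poly scal p) [:x:]" for x
    by (induction p)
      (simp_all add: map_poly_pCons scal.hom_zero ring_homomorphism.hom_zero[OF ring_homomorphism_Const]
        const.hom_add const.hom_mult)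
  then show ?thesis
    unfolding relator_def
    by (simp only: const.hom_add const.hom_mult const.hom_power const.hom_prod M_def at_U_def U_def)
qed

text \<open>\<open>M\<close> is a single monomial, constant in the extra variable, so multiplication
  by it only shifts exponents within each coefficient.\<close>

lemma M_cancel:
  assumes "M * f = M * g"
  shows "f = g"
proof -
  interpret const: ring_homomorphism "\<lambda>c :: (var, 'k) mpoly. [:c:]"
    by (rule ring_homomorphism_const_poly)
  define a where "a = (\<Sum>i\<le>m. Poly_Mapping.single (VX i) (n i))"
  have "M = [:Poly_Mapping.single a 1:]"
    unfolding M_def const.hom_power[symmetric] const.hom_prod[symmetric] prod_Var_power a_def ..
  then have "poly.coeff (M * f) i = Poly_Mapping.single a 1 * poly.coeff f i" for f i
    by simp
  with assms show "f = g"
    by (intro poly_eqI) (rule single_times_cancel[of a], metis)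
qed

text \<open>The images of \<open>y\<close>, \<open>z\<close>, \<open>t\<close> and the extra
  variable stay free, yet the values on \<open>M\<close>, \<open>U\<close> and \<open>at_U f\<close>
  are determined.\<close>

definition rescales :: "'k \<Rightarrow> ((var, 'k) mpoly poly \<Rightarrow> (var, 'k) mpoly poly) \<Rightarrow> bool"
  where "rescales \<gamma> h \<longleftrightarrow> ring_homomorphism h \<and> (\<forall>c. h (scal c) = scal c) \<and>
    (\<forall>i. h (var (VX i)) = (if i = 0 then scal \<gamma> else 1) * var (VX i))"

lemma rescales_comp:
  assumes "rescales \<gamma> g" "rescales \<delta> h"
  shows "rescales (\<delta> * \<gamma>) (\<lambda>x. g (h x))"
proof -
  interpret g: ring_homomorphism g using assms(1) by (simp add: rescales_def)
  have "g (h (var (VX i))) = (if i = 0 then scal (\<delta> * \<gamma>) else 1) * var (VX i)" for i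
    using assms by (simp only: rescales_def g.hom_mult g.hom_one scal.hom_mult mult.assoc split: if_split) simp
  then show ?thesis
    using assms ring_homomorphism_comp[of g h] by (simp only: rescales_def) simp
qed

context
  fixes \<gamma> h assumes h: "rescales \<gamma> h"
begin

interpretation h: ring_homomorphism h
  using h by (simp add: rescales_def)

lemma rescales_scal: "h (scal c) = scal c"
  using h by (simp add: rescales_def)

lemma rescales_VX: "h (var (VX i)) = (if i = 0 then scal \<gamma> else 1) * var (VX i)"
  using h unfolding rescales_def by blast

lemma rescales_M: "h M = scal (\<gamma> ^ n 0) * M"
proof -
  have "h M = (\<Prod>i\<le>m. (if i = 0 then scal \<gamma> else 1) ^ n i) * M"
    unfolding M_def h.hom_prod prod.distrib[symmetric]
    by (intro prod.cong) (simp_all only: h.hom_power rescales_VX power_mult_distrib)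
  also have "(\<Prod>i\<le>m. (if i = 0 then scal \<gamma> else 1) ^ n i) = (\<Prod>i\<le>m. if i = 0 then scal \<gamma> ^ n 0 else 1)"
    by (intro prod.cong) auto
  also have "\<dots> = scal (\<gamma> ^ n 0)"
    by (simp add: prod.delta scal.hom_power)
  finally show ?thesis .
qed

lemma rescales_U: "h U = scal \<gamma> * U"
proof -
  have "h U = (\<Prod>i\<le>m. if i = 0 then scal \<gamma> else 1) * U"
    unfolding U_def h.hom_prod prod.distrib[symmetric] by (simp only: rescales_VX)
  then show ?thesis by (simp add: prod.delta)
qed

text \<open>\<open>U\<close> contains \<open>x_0\<close> exactly once, so \<open>u\<close> is
  replaced by \<open>\<gamma> u\<close>.\<close>

lemma rescales_at_U: "h (at_U f) = at_U (pcompose f [:0, \<gamma>:])"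
proof (induction f)
  case 0
  show ?case by (simp add: at_U.hom_zero h.hom_zero)
next
  case (pCons a f)
  have "at_U [:0, \<gamma>:] = scal \<gamma> * U" "at_U [:a:] = scal a"
    by (simp_all add: at_U_pCons scal.hom_zero at_U.hom_zero mult.commute)
  then have "at_U (pcompose (pCons a f) [:0, \<gamma>:]) =
      scal a + scal \<gamma> * U * at_U (pcompose f [:0, \<gamma>:])"
    by (simp only: pcompose_pCons at_U.hom_add at_U.hom_mult)
  also have "\<dots> = h (at_U (pCons a f))"
    by (simp only: at_U_pCons h.hom_add h.hom_mult rescales_scal rescales_U pCons.IH)
  finally show ?case ..
qed

end

lemma rescales_one_fixes:
  assumes "rescales 1 h"
  shows "h (var (VX i)) = var (VX i)" "h M = M" "h (at_U f) = at_U f"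
  using rescales_VX[OF assms] rescales_M[OF assms] rescales_at_U[OF assms]
  by (auto simp: scal.hom_one)

text \<open>Modulo \<open>M\<close> the prescribed images already send \<open>F p\<close> to
  \<open>L * F p'\<close>: \<open>D\<close> and \<open>E\<close> vanish, and \<open>A ^ q\<close>
  and \<open>B ^ r\<close> both become \<open>L\<close>. The image of \<open>VY\<close> absorbs the
  remaining multiple of \<open>M\<close>; it depends only on the given data, hence is found before
  any \<open>h\<close>.\<close>

lemma exists_image_of_VY:
  assumes "\<gamma> \<noteq> 0" and closed': "A \<in> P" "B \<in> P" "L \<in> P" "D \<in> P" "E \<in> P" "x \<in> P" "y \<in> P"
    and "D \<simeq> 0" "E \<simeq> 0" "A ^ q \<simeq> L" "B ^ r \<simeq> L"
    and L: "L * at_U p' \<simeq> scal \<gamma> * at_U (pcompose p [:0, \<gamma>:])"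
  shows "\<exists>v\<in>P. \<forall>h. rescales \<gamma> h \<longrightarrow> h (var VY) = v \<longrightarrow> h (var VZ) = A * var VZ + D * x \<longrightarrow>
    h (var VT) = B * var VT + E * y \<longrightarrow> h (F p) = L * F p'"
proof -
  note closed = closed closed' at_U_closed var_closed
  have power: "(A * z + D * x) ^ j \<simeq> L * z ^ j"
    if "A ^ j \<simeq> L" "z \<in> P" "A \<in> P" "D \<in> P" "x \<in> P" "D \<simeq> 0" for A D x z j
  proof -
    have "A * z + D * x \<simeq> A * z + 0 * x"
      by (intro cong_mod_add congM_mult cong_mod_refl that)
    then have "(A * z + D * x) ^ j \<simeq> (A * z + 0 * x) ^ j"
      by (intro congM_power closed that)
    also have "(A * z + 0 * x) ^ j = A ^ j * z ^ j" by (simp add: power_mult_distrib)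
    also have "\<dots> \<simeq> L * z ^ j"
      by (intro congM_mult cong_mod_refl closed that)
    finally show ?thesis .
  qed
  have L': "scal \<gamma> * at_U (pcompose p [:0, \<gamma>:]) \<simeq> L * at_U p'"
  proof -
    obtain d where "d \<in> P" "L * at_U p' - scal \<gamma> * at_U (pcompose p [:0, \<gamma>:]) = M * d"
      using L unfolding congM_iff by blast
    then have "scal \<gamma> * at_U (pcompose p [:0, \<gamma>:]) - L * at_U p' = M * (- d)"
      unfolding mult_minus_right by (subst minus_diff_eq[symmetric]) (rule arg_cong[of _ _ uminus])
    then show ?thesis
      using \<open>d \<in> P\<close> closed(6) unfolding congM_iff by blast
  qed
  have "(A * var VZ + D * x) ^ q + (B * var VT + E * y) ^ r
      + var (VX 0) * (scal \<gamma> * at_U (pcompose p [:0, \<gamma>:]))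
    \<simeq> L * var VZ ^ q + L * var VT ^ r + var (VX 0) * (L * at_U p')"
  proof (intro cong_mod_add)
    show "(A * var VZ + D * x) ^ q \<simeq> L * var VZ ^ q" "(B * var VT + E * y) ^ r \<simeq> L * var VT ^ r"
      by (rule power; fact | rule var_closed)+
    show "var (VX 0) * (scal \<gamma> * at_U (pcompose p [:0, \<gamma>:])) \<simeq> var (VX 0) * (L * at_U p')"
      by (rule congM_mult[OF _ _ cong_mod_refl L']) (intro closed le0)+
  qed
  from congM_E[OF this] obtain d where d: "d \<in> P" "(A * var VZ + D * x) ^ q + (B * var VT + E * y) ^ r
      + var (VX 0) * (scal \<gamma> * at_U (pcompose p [:0, \<gamma>:]))
    = L * var VZ ^ q + L * var VT ^ r + var (VX 0) * (L * at_U p') + M * d"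
    by blast
  show ?thesis
  proof (intro bexI allI impI)
    \<comment> \<open>As \<open>h\<close> multiplies \<open>M\<close> by
      \<open>\<gamma> ^ n 0\<close>, the power of \<open>inverse \<gamma>\<close> undoes this
      factor, and \<open>- d\<close> cancels the error \<open>M * d\<close>.\<close>
    let ?v = "scal (inverse \<gamma> ^ n 0) * (L * var VY - d)"
    show "?v \<in> P" by (intro closed d)
    fix h assume h: "rescales \<gamma> h" "h (var VY) = ?v" "h (var VZ) = A * var VZ + D * x"
      "h (var VT) = B * var VT + E * y"
    interpret h: ring_homomorphism h using h by (simp add: rescales_def)
    have inv: "scal (\<gamma> ^ n 0) * scal (inverse \<gamma> ^ n 0) = 1"
      unfolding scal.hom_mult[symmetric] power_mult_distrib[symmetric] right_inverse[OF assms(1)]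
        power_one scal.hom_one ..
    have v: "scal (\<gamma> ^ n 0) * M * ?v = M * (L * var VY - d)"
    proof -
      have "a * M * (b * x) = (a * b) * (M * x)" for a b x by (simp only: mult_ac)
      then show ?thesis by (simp only: inv mult_1_left)
    qed
    have "h (F p) = scal (\<gamma> ^ n 0) * M * ?v + (A * var VZ + D * x) ^ q + (B * var VT + E * y) ^ r
        + scal \<gamma> * var (VX 0) * at_U (pcompose p [:0, \<gamma>:])"
      unfolding relator_eq h.hom_add h.hom_mult h.hom_power h(2-4) rescales_M[OF h(1)]
        rescales_at_U[OF h(1)] rescales_VX[OF h(1), of 0] if_P[OF refl] ..
    also have "\<dots> = M * (L * var VY - d) + ((A * var VZ + D * x) ^ q + (B * var VT + E * y) ^ r
        + var (VX 0) * (scal \<gamma> * at_U (pcompose p [:0, \<gamma>:])))"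
      unfolding v by (simp only: mult.assoc mult.left_commute add.assoc)
    also have "\<dots> = L * F p'"
    proof -
      have "M * (L * y - d) + (L * z + L * t + x * (L * u) + M * d) = L * (M * y + z + t + x * u)"
        for y z t x u by (simp add: algebra_simps)
      then show ?thesis unfolding d(2) relator_eq .
    qed
    finally show "h (F p) = L * F p'" .
  qed
qed

text \<open>All generators but \<open>VY\<close> are fixed, so \<open>h (F p) - F p\<close> equals
  \<open>M * (h (var VY) - var VY)\<close>. It is also \<open>(V - 1) * F p\<close> with
  \<open>V - 1\<close> a multiple of \<open>M\<close>. Cancelling \<open>M\<close> shows that
  \<open>VY\<close> moves by a multiple of \<open>F p\<close>.\<close>

lemma cong_ident_mod_F:
  assumes h: "rescales 1 h" and h_closed: "\<And>g. g \<in> P \<Longrightarrow> h g \<in> P"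
    and fixed: "h (var VZ) = var VZ" "h (var VT) = var VT" "h W = W"
    and F: "h (F p) = V * F p" and V: "V \<simeq> 1" and g: "g \<in> P"
  shows "cong_mod (ambient_vars m) (F p) (h g) g"
proof (rule ring_homomorphism_cong_ident)
  interpret h: ring_homomorphism h using h by (simp add: rescales_def)
  show "ring_homomorphism h" by (rule h.ring_homomorphism_axioms)
  obtain d where d: "d \<in> P" "V - 1 = M * d" using V unfolding congM_iff by blast
  have "h (F p) - F p = M * (h (var VY) - var VY)"
    unfolding relator_eq h.hom_add h.hom_mult h.hom_power fixed rescales_one_fixes[OF h]
    by (simp only: algebra_simps add_diff_cancel)
  moreover have "h (F p) - F p = (V - 1) * F p"
    unfolding F by (simp only: left_diff_distrib mult_1)
  ultimately have "M * (h (var VY) - var VY) = M * (F p * d)"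
    unfolding d(2) by (simp only: mult_ac)
  then have "h (var VY) - var VY = F p * d" by (rule M_cancel)
  then have "cong_mod (ambient_vars m) (F p) (h (var VY)) (var VY)"
    using d(1) unfolding cong_mod_def P_def by blast
  then show "cong_mod (ambient_vars m) (F p) (h (var v)) (var v)" if "v \<in> ambient_vars m" for v
    using that by (auto simp: ambient_vars_def fixed rescales_one_fixes[OF h] intro: cong_mod_refl)
qed (use assms rescales_scal[OF h] in \<open>auto simp: P_def intro: cong_mod_refl\<close>)

text \<open>\<open>exists_image_of_VY\<close> supplies the one missing image, and substitution
  realises all of them. The image of the extra variable is free because \<open>F p\<close> does not
  involve it.\<close>

lemma exists_twist:
  assumes "\<gamma> \<noteq> 0" and closed': "A \<in> P" "B \<in> P" "L \<in> P" "D \<in> P" "E \<in> P" "x \<in> P" "y \<in> P"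
    and cong: "D \<simeq> 0" "E \<simeq> 0" "A ^ q \<simeq> L" "B ^ r \<simeq> L"
      "L * at_U p' \<simeq> scal \<gamma> * at_U (pcompose p [:0, \<gamma>:])"
    and w: "w \<in> P"
  obtains h where "rescales \<gamma> h" "\<forall>g\<in>P. h g \<in> P" "h (var VZ) = A * var VZ + D * x"
    "h (var VT) = B * var VT + E * y" "h W = w" "h (F p) = L * F p'"
proof -
  obtain v where v: "v \<in> P" "\<And>h. rescales \<gamma> h \<Longrightarrow> h (var VY) = v \<Longrightarrow>
      h (var VZ) = A * var VZ + D * x \<Longrightarrow> h (var VT) = B * var VT + E * y \<Longrightarrow> h (F p) = L * F p'"
    using exists_image_of_VY[OF assms(1) closed' cong] by blast
  define e where "e = case_var (\<lambda>i. (if i = 0 then scal \<gamma> else 1) * var (VX i)) v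
    (A * var VZ + D * x) (B * var VT + E * y)"
  have e: "e (VX i) = (if i = 0 then scal \<gamma> else 1) * var (VX i)" "e VY = v"
    "e VZ = A * var VZ + D * x" "e VT = B * var VT + E * y" for i
    by (simp_all add: e_def)
  have h: "rescales \<gamma> (poly_lift e w)"
    unfolding rescales_def poly_lift_simps e by (simp only: ring_homomorphism_poly_lift simp_thms)
  have "\<forall>g\<in>P. poly_lift e w g \<in> P"
  proof
    fix g assume "g \<in> P"
    then show "poly_lift e w g \<in> P"
      unfolding P_def
    proof (rule ring_homomorphism_closed[OF ring_homomorphism_poly_lift],
        unfold P_def[symmetric] poly_lift_simps)
      show "e u \<in> P" if "u \<in> ambient_vars m" for u
        using that unfolding ambient_vars_def
        by (auto simp only: e intro!: closed closed' var_closed v(1) split: if_split)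
    qed (rule closed w)+
  qed
  then show ?thesis
    by (rule that[OF h]) (simp_all only: poly_lift_simps e v(2)[OF h])
qed

text \<open>\<open>\<phi>\<close> uses two matrices of determinant \<open>1\<close> in turn: the
  first acts on \<open>z\<close> and the extra variable, the second on \<open>t\<close> and the
  second output of the first. \<open>\<psi>\<close> uses the inverse matrices in reverse order, with
  coefficients transported by the inverse rescaling.\<close>

lemma exists_mutually_inverse_twists:
  assumes "q > 0" "r > 0" and "poly p 0 \<noteq> 0" "poly p' 0 \<noteq> 0"
  obtains \<phi> \<psi> L L' c where "rescales c \<phi>" "rescales (inverse c) \<psi>"
    "\<forall>g\<in>P. \<phi> g \<in> P" "\<forall>g\<in>P. \<psi> g \<in> P"
    "\<phi> (F p) = L * F p'" "\<psi> (F p') = L' * F p" "L \<in> P" "L' \<in> P"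
    "\<forall>g\<in>P. cong_mod (ambient_vars m) (F p) (\<psi> (\<phi> g)) g"
    "\<forall>g\<in>P. cong_mod (ambient_vars m) (F p') (\<phi> (\<psi> g)) g"
proof -
  obtain c a a' e b b' f l l' where c: "c \<noteq> 0"
    and det: "a * a' + e\<^sup>2 = 1" "b * b' + f\<^sup>2 = 1"
    and small: "[:0, 1:] ^ N dvd e" "[:0, 1:] ^ N dvd f" and ll': "[:0, 1:] ^ N dvd l * l' - 1"
    and pow: "a ^ q = l" "b ^ r = l" "[:0, 1:] ^ N dvd a' ^ q - l'" "[:0, 1:] ^ N dvd b' ^ r - l'"
    and l: "[:0, 1:] ^ N dvd l * p' - smult c (pcompose p [:0, c:])"
    using exists_twist_data[OF assms(3,4,1,2)] by metis
  \<comment> \<open>\<open>\<psi>\<close> replaces \<open>u\<close> by \<open>u / c\<close>, so its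
    coefficients pass through \<open>\<sigma>\<close>; this gives
    \<open>\<psi> (at_U g) = \<tau> g\<close> and \<open>\<phi> (\<tau> g) = at_U g\<close>.\<close>
  define \<sigma> where "\<sigma> g = pcompose g [:0, inverse c:]" for g
  interpret \<sigma>: ring_homomorphism \<sigma>
    unfolding \<sigma>_def[abs_def] by (rule ring_homomorphism_pcompose)
  define \<tau> where "\<tau> g = at_U (\<sigma> g)" for g
  interpret \<tau>: ring_homomorphism \<tau>
    unfolding \<tau>_def[abs_def]
    by (rule ring_homomorphism_comp[OF at_U.ring_homomorphism_axioms \<sigma>.ring_homomorphism_axioms])
  have \<tau>_closed: "\<tau> g \<in> P" for g by (simp add: \<tau>_def at_U_closed)
  have \<sigma>_dvd: "[:0, 1:] ^ N dvd \<sigma> g - \<sigma> h" if "[:0, 1:] ^ N dvd g - h" for g h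
    using X_power_dvd_pcompose[OF that] unfolding \<sigma>_def pcompose_diff .
  have cong: "at_U g \<simeq> at_U h" "\<tau> g \<simeq> \<tau> h" if "[:0, 1:] ^ N dvd g - h" for g h
    using that \<sigma>_dvd by (simp_all add: \<tau>_def congM_at_U)

  have cong_l: "at_U l * at_U p' \<simeq> scal c * at_U (pcompose p [:0, c:])"
    using cong(1)[OF l] by (simp only: at_U.hom_mult at_U_smult)
  \<comment> \<open>The counterpart of \<open>cong_l\<close> for \<open>\<psi>\<close>: multiply the
    congruence by \<open>l'\<close>, substitute \<open>u / c\<close> for \<open>u\<close>, then
    divide by \<open>c\<close>.\<close>
  have "l' * (l * p' - smult c (pcompose p [:0, c:])) - (l * l' - 1) * p' =
      p' - smult c (l' * pcompose p [:0, c:])"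
    by (simp add: algebra_simps)
  then have "[:0, 1:] ^ N dvd p' - smult c (l' * pcompose p [:0, c:])"
    using dvd_diff[OF dvd_mult[OF l, of l'] dvd_mult2[OF ll', of p']] by simp
  then have "[:0, 1:] ^ N dvd \<sigma> p' - \<sigma> (smult c (l' * pcompose p [:0, c:]))"
    by (rule \<sigma>_dvd)
  also have "\<sigma> (smult c (l' * pcompose p [:0, c:])) = smult c (\<sigma> l' * p)"
    by (simp add: \<sigma>_def pcompose_smult pcompose_mult pcompose_rescale_inverse[OF c])
  finally have "[:0, 1:] ^ N dvd smult (- inverse c) (\<sigma> p' - smult c (\<sigma> l' * p))"
    by (rule dvd_smult)
  also have "\<dots> = \<sigma> l' * p - smult (inverse c) (\<sigma> p')"
    using c by (simp add: smult_diff_right)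
  finally have cong_l': "\<tau> l' * at_U p \<simeq> scal (inverse c) * at_U (pcompose p' [:0, inverse c:])"
    using congM_at_U by (simp only: \<tau>_def \<sigma>_def at_U.hom_mult[symmetric] at_U_smult[symmetric])

  \<comment> \<open>\<open>s\<close> is the second output of the first matrix on
    \<open>(z, W)\<close>, and \<open>v\<close> that of the inverse second matrix on
    \<open>(t, W)\<close>. They correspond to each other: \<open>\<psi> s = v\<close> and
    \<open>\<phi> v = s\<close>.\<close>
  define s where "s = at_U e * var VZ + at_U a' * W"
  define v where "v = \<tau> b * W - \<tau> f * var VT"
  note closed = closed var_closed at_U_closed \<tau>_closed
  have s: "s \<in> P" and v: "v \<in> P" by (auto simp only: s_def v_def intro!: closed)
  have small': "at_U e \<simeq> 0" "at_U f \<simeq> 0" "\<tau> e \<simeq> 0" "\<tau> f \<simeq> 0"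
    using cong[of e 0] cong[of f 0] small by (simp_all add: at_U.hom_zero \<tau>.hom_zero)
  have pow': "at_U a ^ q \<simeq> at_U l" "at_U b ^ r \<simeq> at_U l"
    unfolding at_U.hom_power[symmetric] pow by (rule cong_mod_refl)+
  have pow'': "\<tau> a' ^ q \<simeq> \<tau> l'" "\<tau> b' ^ r \<simeq> \<tau> l'"
    unfolding \<tau>.hom_power[symmetric] by (rule cong pow)+
  have images: "- W \<in> P" "- s \<in> P" "at_U f * var VT + at_U b' * s \<in> P"
      "\<tau> a * v - \<tau> e * var VZ \<in> P"
    by (intro closed s v)+
  obtain \<phi> where \<phi>: "rescales c \<phi>" "\<forall>g\<in>P. \<phi> g \<in> P"
      "\<phi> (var VZ) = at_U a * var VZ + at_U e * (- W)"
      "\<phi> (var VT) = at_U b * var VT + at_U f * (- s)"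
      "\<phi> W = at_U f * var VT + at_U b' * s" "\<phi> (F p) = at_U l * F p'"
    by (rule exists_twist[OF c at_U_closed at_U_closed at_U_closed at_U_closed at_U_closed
          images(1,2) small'(1,2) pow' cong_l images(3)]) (rule that)
  obtain \<psi> where \<psi>: "rescales (inverse c) \<psi>" "\<forall>g\<in>P. \<psi> g \<in> P"
      "\<psi> (var VZ) = \<tau> a' * var VZ + \<tau> e * v"
      "\<psi> (var VT) = \<tau> b' * var VT + \<tau> f * W"
      "\<psi> W = \<tau> a * v - \<tau> e * var VZ" "\<psi> (F p') = \<tau> l' * F p"
    by (rule exists_twist[OF nonzero_imp_inverse_nonzero[OF c] \<tau>_closed \<tau>_closed \<tau>_closed
          \<tau>_closed \<tau>_closed v closed(9) small'(3,4) pow'' cong_l' images(4)]) (rule that)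

  interpret \<phi>: ring_homomorphism \<phi> using \<phi>(1) by (simp add: rescales_def)
  interpret \<psi>: ring_homomorphism \<psi> using \<psi>(1) by (simp add: rescales_def)
  have \<psi>_at_U: "\<psi> (at_U g) = \<tau> g" for g
    by (simp add: rescales_at_U[OF \<psi>(1)] \<tau>_def \<sigma>_def)
  have \<phi>_\<tau>: "\<phi> (\<tau> g) = at_U g" for g
    by (simp add: \<tau>_def rescales_at_U[OF \<phi>(1)] \<sigma>_def pcompose_rescale_inverse[OF c])
  have det_at_U: "at_U a * at_U a' + at_U e * at_U e = 1" "at_U b * at_U b' + at_U f * at_U f = 1"
    using det by (simp_all only: power2_eq_square flip: at_U.hom_mult at_U.hom_add) (simp_all only: at_U.hom_one)
  have det_\<tau>: "\<tau> a * \<tau> a' + \<tau> e * \<tau> e = 1" "\<tau> b * \<tau> b' + \<tau> f * \<tau> f = 1"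
    using det by (simp_all only: power2_eq_square flip: \<tau>.hom_mult \<tau>.hom_add) (simp_all only: \<tau>.hom_one)
  \<comment> \<open>The products, in both orders, of the matrix with rows \<open>(x1, -y)\<close>,
    \<open>(y, x2)\<close> and its inverse with rows \<open>(x2, y)\<close>,
    \<open>(-y, x1)\<close>, applied to \<open>(z, u)\<close>.\<close>
  have matrix: "x1 * (x2 * z + y * u) + y * (- (x1 * u - y * z)) = z"
      "x2 * (x1 * z + y * (- u)) + y * (y * z + x2 * u) = z"
      "y * (x2 * z + y * u) + x2 * (x1 * u - y * z) = u"
      "x1 * (y * z + x2 * u) - y * (x1 * z + y * (- u)) = u"
    if "x1 * x2 + y * y = 1" for x1 x2 y z u :: "(var, 'k) mpoly poly"
  proof -
    have "(x1 * x2 + y * y) * z = z" "(x1 * x2 + y * y) * u = u" by (simp_all only: that mult_1)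
    then show "x1 * (x2 * z + y * u) + y * (- (x1 * u - y * z)) = z"
      "x2 * (x1 * z + y * (- u)) + y * (y * z + x2 * u) = z"
      "y * (x2 * z + y * u) + x2 * (x1 * u - y * z) = u"
      "x1 * (y * z + x2 * u) - y * (x1 * z + y * (- u)) = u"
      by (simp_all add: algebra_simps)
  qed
  note homs = \<phi>.hom_simps \<psi>.hom_simps \<psi>_at_U \<phi>_\<tau>

  have \<psi>s: "\<psi> s = v"
    unfolding s_def homs \<psi>(3,5) by (rule matrix[OF det_\<tau>(1)])
  have \<phi>v: "\<phi> v = s"
    unfolding v_def homs \<phi>(4,5) by (rule matrix(4)[OF det_at_U(2)])
  have one: "rescales 1 (\<lambda>x. \<psi> (\<phi> x))" "rescales 1 (\<lambda>x. \<phi> (\<psi> x))"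
    using rescales_comp[OF \<psi>(1) \<phi>(1)] rescales_comp[OF \<phi>(1) \<psi>(1)] c by simp_all
  have "cong_mod (ambient_vars m) (F p) (\<psi> (\<phi> g)) g" if "g \<in> P" for g
  proof (rule cong_ident_mod_F[OF one(1)])
    show "\<psi> (\<phi> (var VZ)) = var VZ"
      unfolding \<phi>(3) homs \<psi>(3,5) by (rule matrix[OF det_\<tau>(1)])
    show "\<psi> (\<phi> (var VT)) = var VT"
      unfolding \<phi>(4) homs \<psi>(4) \<psi>s v_def by (rule matrix[OF det_\<tau>(2)])
    show "\<psi> (\<phi> W) = W"
      unfolding \<phi>(5) homs \<psi>(4) \<psi>s v_def by (rule matrix[OF det_\<tau>(2)])
    \<comment> \<open>The factors coming from \<open>\<phi>\<close> and \<open>\<psi>\<close>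
      multiply to the image of \<open>l * l'\<close>, which is congruent to \<open>1\<close>, as
      \<open>cong_ident_mod_F\<close> demands.\<close>
    show "\<psi> (\<phi> (F p)) = \<tau> (l * l') * F p"
      unfolding \<phi>(6) homs \<psi>(6) \<tau>.hom_mult by (rule mult.assoc[symmetric])
    show "\<tau> (l * l') \<simeq> 1"
      using cong(2)[OF ll'] by (simp only: \<tau>.hom_one)
  qed (use that \<phi>(2) \<psi>(2) in auto)
  moreover have "cong_mod (ambient_vars m) (F p') (\<phi> (\<psi> g)) g" if "g \<in> P" for g
  proof (rule cong_ident_mod_F[OF one(2)])
    show "\<phi> (\<psi> (var VZ)) = var VZ"
      unfolding \<psi>(3) homs \<phi>(3) \<phi>v s_def by (rule matrix(2)[OF det_at_U(1)])
    show "\<phi> (\<psi> (var VT)) = var VT"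
      unfolding \<psi>(4) homs \<phi>(4,5) by (rule matrix(2)[OF det_at_U(2)])
    show "\<phi> (\<psi> W) = W"
      unfolding \<psi>(5) homs \<phi>(3) \<phi>v s_def by (rule matrix(4)[OF det_at_U(1)])
    show "\<phi> (\<psi> (F p')) = at_U (l * l') * F p'"
      unfolding \<psi>(6) homs \<phi>(6) at_U.hom_mult by (simp only: mult_ac)
    show "at_U (l * l') \<simeq> 1"
      using cong(1)[OF ll'] by (simp only: at_U.hom_one)
  qed (use that \<phi>(2) \<psi>(2) in auto)
  ultimately show ?thesis
    using that[OF \<phi>(1) \<psi>(1) \<phi>(2) \<psi>(2) \<phi>(6) \<psi>(6) at_U_closed \<tau>_closed] by blast
qed

end

section \<open>Descent to the polynomial rings over the quotient algebras\<close>

theorem proposition3: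
  fixes m q r :: nat and n :: "nat \<Rightarrow> nat" and p p' :: "'k::field_char_0 poly"
  assumes "q \<ge> 2" and "r \<ge> 2" and "gcd q r = 1"
    and "\<And>i. i \<le> m \<Longrightarrow> n i > 1"
    and "poly p 0 \<noteq> 0" and "poly p' 0 \<noteq> 0"
  shows "algebra_isomorphic
    (UP_scalar (R_scalar m n q r p) (R_alg m n q r p)) (UP (R_alg m n q r p))
    (UP_scalar (R_scalar m n q r p') (R_alg m n q r p')) (UP (R_alg m n q r p'))"
proof -
  define V where "V = ambient_vars m"
  define P where "P = carrier (mpoly_poly_ring V :: (var, 'k) mpoly poly ring)"
  \<comment> \<open>The sum of the exponents serves as a common bound \<open>N\<close>.\<close>
  interpret cylinder m n q r "\<Sum>i\<le>m. n i" P
    by unfold_locales (auto simp: P_def V_def intro: member_le_sum)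
  \<comment> \<open>\<open>E p\<close> projects the cylinder onto the polynomial ring over
    \<open>R_alg m n q r p\<close>; by \<open>E_eq\<close> below its kernel is the ideal of
    \<open>F p\<close>.\<close>
  define E where "E p = quotient_poly V (relation_ideal m n q r (p :: 'k poly))" for p
  have ideal: "ideal (relation_ideal m n q r p) (mpoly_ring V)" for p :: "'k poly"
    using ideal_relation_ideal unfolding V_def ambient_ring_def .
  have R: "R_alg m n q r p = mpoly_ring V Quot relation_ideal m n q r p" for p :: "'k poly"
    by (simp add: R_alg_def ambient_ring_def V_def)
  have E_hom: "E p \<in> ring_hom (mpoly_poly_ring V) (UP (R_alg m n q r p))"
    and E_surj: "E p ` carrier (mpoly_poly_ring V) = carrier (UP (R_alg m n q r p))" for p
    unfolding E_def R by (rule quotient_poly_hom[OF ideal] quotient_poly_surj[OF ideal])+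
  have E_eq: "E p f = E p g \<longleftrightarrow> cong_mod V (F p) f g" if "f \<in> P" "g \<in> P" for p f g
    using quotient_poly_eq_iff[of "relator m n q r p" V f g] relator_closed[of m n q r p] that
    unfolding E_def cong_mod_def P_def relation_ideal_def ambient_ring_def V_def by blast
  have E_scal: "E p (scal c) = UP_scalar (R_scalar m n q r p) (R_alg m n q r p) c" for p c
    unfolding E_def UP_scalar_def R_scalar_def R
    by (subst quotient_poly_const[OF ideal]) (simp_all add: mpoly_ring_closed ambient_ring_def V_def)

  have "q > 0" "r > 0" using assms(1,2) by simp_all
  then obtain \<phi> \<psi> L L' c where twists: "rescales c \<phi>" "rescales (inverse c) \<psi>"
    "\<forall>g\<in>P. \<phi> g \<in> P" "\<forall>g\<in>P. \<psi> g \<in> P"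
    "\<phi> (F p) = L * F p'" "\<psi> (F p') = L' * F p" "L \<in> P" "L' \<in> P" and
    inv: "\<forall>g\<in>P. cong_mod V (F p) (\<psi> (\<phi> g)) g" "\<forall>g\<in>P. cong_mod V (F p') (\<phi> (\<psi> g)) g"
    by (rule exists_mutually_inverse_twists[OF _ _ assms(5,6), folded V_def]) (rule that)
  note \<phi> = twists(1,3,5,7) and \<psi> = twists(2,4,6,8)
  have hom: "h \<in> ring_hom (mpoly_poly_ring V) (mpoly_poly_ring V)"
    if "rescales \<gamma> h" "\<forall>g\<in>P. h g \<in> P" for \<gamma> h
    using that unfolding P_def V_def rescales_def ring_homomorphism_def by (intro ring_hom_memI) auto
  \<comment> \<open>A homomorphism sending \<open>F p\<close> to a multiple of \<open>F p'\<close>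
    carries the first ideal into the second.\<close>
  have cong: "cong_mod V (F p') (h f) (h g)"
    if h: "rescales \<gamma> h" "\<forall>g\<in>P. h g \<in> P" and F: "h (F p) = L * F p'" "L \<in> P"
      and fg: "cong_mod V (F p) f g" for \<gamma> h L p p' f g
  proof -
    interpret h: ring_homomorphism h using h(1) by (simp add: rescales_def)
    obtain d where d: "d \<in> P" "f - g = F p * d" using fg unfolding cong_mod_def P_def V_def by blast
    have "h f - h g = F p' * (L * h d)"
      unfolding h.hom_diff[symmetric] d(2) h.hom_mult F by (simp only: mult_ac)
    then show ?thesis
      using h(2) d(1) F(2) closed(5) unfolding cong_mod_def P_def V_def by blast
  qed
  have "ring (mpoly_poly_ring V :: (var, 'k) mpoly poly ring)"
  proof (rule ringI)
    show "abelian_group (mpoly_poly_ring V :: (var, 'k) mpoly poly ring)"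
    proof (rule abelian_groupI)
      fix f :: "(var, 'k) mpoly poly" assume "f \<in> carrier (mpoly_poly_ring V)"
      then show "\<exists>g \<in> carrier (mpoly_poly_ring V). g \<oplus>\<^bsub>mpoly_poly_ring V\<^esub> f = \<zero>\<^bsub>mpoly_poly_ring V\<^esub>"
        by (intro bexI[of _ "- f"]) (auto intro: mpoly_poly_ring_closed)
    qed (auto simp: ac_simps intro: mpoly_poly_ring_closed)
    show "Group.monoid (mpoly_poly_ring V :: (var, 'k) mpoly poly ring)"
      by (rule monoidI) (auto simp: ac_simps intro: mpoly_poly_ring_closed)
  qed (auto simp: algebra_simps)
  then have "\<exists>h \<in> ring_iso (UP (R_alg m n q r p)) (UP (R_alg m n q r p')).
      \<forall>x\<in>carrier (mpoly_poly_ring V). h (E p x) = E p' (\<phi> x)"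
  proof (rule ring_iso_between_quotients[OF E_hom E_surj E_hom E_surj _ hom[OF \<phi>(1,2)] hom[OF \<psi>(1,2)],
        of p p'], unfold P_def[folded V_def, symmetric])
    show "E p' (\<phi> x) = E p' (\<phi> y)" if "x \<in> P" "y \<in> P" "E p x = E p y" for x y
      using that \<phi>(2) cong[OF \<phi>] by (simp add: E_eq)
    show "E p (\<psi> x) = E p (\<psi> y)" if "x \<in> P" "y \<in> P" "E p' x = E p' y" for x y
      using that \<psi>(2) cong[OF \<psi>] by (simp add: E_eq)
  qed (use inv \<phi>(2) \<psi>(2) in \<open>simp_all add: E_eq\<close>)
  then obtain h where h: "h \<in> ring_iso (UP (R_alg m n q r p)) (UP (R_alg m n q r p'))"
      "\<And>x. x \<in> P \<Longrightarrow> h (E p x) = E p' (\<phi> x)"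
    unfolding P_def V_def by blast
  \<comment> \<open>The structure maps come from the constants \<open>scal c\<close>, which
    \<open>\<phi>\<close> fixes.\<close>
  have "h (UP_scalar (R_scalar m n q r p) (R_alg m n q r p) c) =
      UP_scalar (R_scalar m n q r p') (R_alg m n q r p') c" for c
    using h(2)[of "scal c"] closed(8) by (simp add: E_scal rescales_scal[OF \<phi>(1)])
  with h(1) show ?thesis
    unfolding algebra_isomorphic_def by blast
qed

end
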